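(* Let $G$ be a countable discrete group. (1) If $G$ is a Kazhdan group, then every isometric action of $G$ on a median space is bounded. (2) If $G$ admits a proper isometric action on a (nonempty) median space, then $G$ is a Haagerup group.
   Context: For a metric space $X$ with distance $|x\,y|$, the geodesic interval between $x,y\in X$ is $[x,y]=\{t\in X: |x\,t|+|t\,y|=|x\,y|\}$. A metric space $X$ is a median space if, for every $x,y,z\in X$, the geodesic intervals $[x,y]$, $[y,z]$, $[z,x]$ have exactly one common point. An isometric action of a group $G$ on a metric space $X$ is bounded if for some (equivalently, all) $x\in X$ the orbit $\{gx: g\in G\}$ is bounded. It is proper if for some (equivalently, all) $x\in X$ the set $\{g\in G: |x\,gx|\le R\}$ is finite for each $R\ge 0$. A group $G$ is a Kazhdan group if every isometric action of $G$ on a real Hilbert space has a (globally) fixed point. A group $G$ is a Haagerup group if $G$ admits a proper isometric action on a real Hilbert space. Isometric actions on Hilbert spaces are not required to be linear; they are automatically affine. *)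

theory Defs
  imports
    "HOL-Analysis.Analysis"
    "HOL-Algebra.Group_Action"
    "HOL-Algebra.Module"
    "HOL-Library.Equipollence"
begin

subsection \<open>Median spaces\<close>

definition geodesic_interval :: "'m set \<Rightarrow> ('m \<Rightarrow> 'm \<Rightarrow> real) \<Rightarrow> 'm \<Rightarrow> 'm \<Rightarrow> 'm set" where
  "geodesic_interval X d x y = {t \<in> X. d x t + d t y = d x y}"

locale median_space = Metric_space X d
  for X :: "'m set" and d :: "'m \<Rightarrow> 'm \<Rightarrow> real" +
  assumes unique_median:
    "\<lbrakk>x \<in> X; y \<in> X; z \<in> X\<rbrakk> \<Longrightarrow>
      \<exists>!t. t \<in> geodesic_interval X d x y \<inter> geodesic_interval X d y z \<inter> geodesic_interval X d z x"


subsection \<open>Isometric actions\<close>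

definition isometric_action ::
    "('g, 'b) monoid_scheme \<Rightarrow> 'x set \<Rightarrow> ('x \<Rightarrow> 'x \<Rightarrow> real) \<Rightarrow> ('g \<Rightarrow> 'x \<Rightarrow> 'x) \<Rightarrow> bool" where
  "isometric_action G X d \<phi> \<longleftrightarrow>
    group_action G X \<phi> \<and>
    (\<forall>g \<in> carrier G. \<forall>x \<in> X. \<forall>y \<in> X. d (\<phi> g x) (\<phi> g y) = d x y)"

text \<open>Boundedness and properness are stated for all base points. For an isometric action
  on a nonempty space this is the same as asking it for one base point (proved below); the empty
  space counts as bounded.\<close>

definition bounded_action ::
    "('g, 'b) monoid_scheme \<Rightarrow> 'x set \<Rightarrow> ('x \<Rightarrow> 'x \<Rightarrow> real) \<Rightarrow> ('g \<Rightarrow> 'x \<Rightarrow> 'x) \<Rightarrow> bool" where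
  "bounded_action G X d \<phi> \<longleftrightarrow> (\<forall>x \<in> X. Metric_space.mbounded X d (orbit G \<phi> x))"

definition proper_action ::
    "('g, 'b) monoid_scheme \<Rightarrow> 'x set \<Rightarrow> ('x \<Rightarrow> 'x \<Rightarrow> real) \<Rightarrow> ('g \<Rightarrow> 'x \<Rightarrow> 'x) \<Rightarrow> bool" where
  "proper_action G X d \<phi> \<longleftrightarrow>
    (\<forall>x \<in> X. \<forall>R \<ge> 0. finite {g \<in> carrier G. d x (\<phi> g x) \<le> R})"

lemma isometric_action_closed:
  assumes "isometric_action G X d \<phi>" "g \<in> carrier G" "x \<in> X"
  shows "\<phi> g x \<in> X"
  using assms group_action.element_image unfolding isometric_action_def by fastforce

lemma bounded_action_iff_some:
  assumes "Metric_space X d" "isometric_action G X d \<phi>" "x \<in> X"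
  shows "bounded_action G X d \<phi> \<longleftrightarrow> Metric_space.mbounded X d (orbit G \<phi> x)"
proof -
  interpret Metric_space X d by fact
  have "mbounded (orbit G \<phi> y)" if y: "y \<in> X" and b: "mbounded (orbit G \<phi> x)" for y
  proof -
    from b obtain c B where cB: "orbit G \<phi> x \<subseteq> mcball c B" unfolding mbounded_def by auto
    have c: "c \<in> X" if "g \<in> carrier G" for g
      using cB that unfolding orbit_def by (auto simp: mcball_def)
    have "orbit G \<phi> y \<subseteq> mcball c (B + d x y)"
    proof
      fix t assume "t \<in> orbit G \<phi> y"
      then obtain g where g: "g \<in> carrier G" "t = \<phi> g y" unfolding orbit_def by auto
      have in_X: "\<phi> g x \<in> X" "\<phi> g y \<in> X"
        using isometric_action_closed[OF assms(2) g(1)] assms(3) y by auto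
      have "\<phi> g x \<in> mcball c B" using cB g unfolding orbit_def by auto
      then have "d c (\<phi> g x) \<le> B" by simp
      moreover have "d (\<phi> g x) (\<phi> g y) = d x y"
        using assms g y unfolding isometric_action_def by auto
      moreover have "d c (\<phi> g y) \<le> d c (\<phi> g x) + d (\<phi> g x) (\<phi> g y)"
        using triangle c[OF g(1)] in_X by auto
      ultimately show "t \<in> mcball c (B + d x y)" using g c in_X by auto
    qed
    then show ?thesis unfolding mbounded_def by auto
  qed
  then show ?thesis using assms(3) unfolding bounded_action_def by auto
qed

lemma proper_action_iff_some:
  assumes "Metric_space X d" "isometric_action G X d \<phi>" "x \<in> X"
  shows "proper_action G X d \<phi> \<longleftrightarrow> (\<forall>R \<ge> 0. finite {g \<in> carrier G. d x (\<phi> g x) \<le> R})"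
proof -
  interpret Metric_space X d by fact
  have "finite {g \<in> carrier G. d y (\<phi> g y) \<le> R}"
    if y: "y \<in> X" and f: "\<forall>R \<ge> 0. finite {g \<in> carrier G. d x (\<phi> g x) \<le> R}" and R: "R \<ge> 0"
    for y R
  proof -
    have "{g \<in> carrier G. d y (\<phi> g y) \<le> R} \<subseteq> {g \<in> carrier G. d x (\<phi> g x) \<le> R + 2 * d x y}"
    proof clarify
      fix g assume g: "g \<in> carrier G" "d y (\<phi> g y) \<le> R"
      have in_X: "\<phi> g x \<in> X" "\<phi> g y \<in> X"
        using isometric_action_closed[OF assms(2) g(1)] assms(3) y by auto
      have "d x (\<phi> g x) \<le> d x y + d y (\<phi> g x)" using triangle assms(3) y in_X by auto
      moreover have "d y (\<phi> g x) \<le> d y (\<phi> g y) + d (\<phi> g y) (\<phi> g x)"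
        using triangle y in_X by auto
      moreover have "d (\<phi> g y) (\<phi> g x) = d x y"
        using assms g y commute unfolding isometric_action_def by auto
      ultimately show "d x (\<phi> g x) \<le> R + 2 * d x y" using g by linarith
    qed
    moreover have "R + 2 * d x y \<ge> 0" using R by simp
    ultimately show ?thesis using f finite_subset by blast
  qed
  then show ?thesis using assms(3) unfolding proper_action_def by auto
qed


subsection \<open>Real Hilbert spaces on a carrier set\<close>

text \<open>A property of a group quantifies over all Hilbert spaces, so these cannot be given by a type
  class; they are real vector spaces in the carrier-based sense, with an inner product.\<close>

definition real_ring :: "real ring" where
  "real_ring = \<lparr>carrier = UNIV, mult = (*), one = 1, zero = 0, add = (+)\<rparr>"

text \<open>The value 0 off the carrier is only there because \<^locale>\<open>Metric_space\<close> asks for a distance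
  that is symmetric and nonnegative on the whole type.\<close>

definition ip_dist :: "(real, 'h) module \<Rightarrow> ('h \<Rightarrow> 'h \<Rightarrow> real) \<Rightarrow> 'h \<Rightarrow> 'h \<Rightarrow> real" where
  "ip_dist V ip x y =
    (if x \<in> carrier V \<and> y \<in> carrier V then sqrt (ip (x \<ominus>\<^bsub>V\<^esub> y) (x \<ominus>\<^bsub>V\<^esub> y)) else 0)"

locale real_inner_product_space = module real_ring V
  for V :: "(real, 'h) module" and ip :: "'h \<Rightarrow> 'h \<Rightarrow> real" +
  assumes ip_commute: "\<lbrakk>x \<in> carrier V; y \<in> carrier V\<rbrakk> \<Longrightarrow> ip x y = ip y x"
    and ip_add_left:
      "\<lbrakk>x \<in> carrier V; y \<in> carrier V; z \<in> carrier V\<rbrakk> \<Longrightarrow> ip (x \<oplus>\<^bsub>V\<^esub> y) z = ip x z + ip y z"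
    and ip_smult_left:
      "\<lbrakk>x \<in> carrier V; y \<in> carrier V\<rbrakk> \<Longrightarrow> ip (a \<odot>\<^bsub>V\<^esub> x) y = a * ip x y"
    and ip_nonneg: "x \<in> carrier V \<Longrightarrow> 0 \<le> ip x x"
    and ip_eq_zero: "\<lbrakk>x \<in> carrier V; ip x x = 0\<rbrakk> \<Longrightarrow> x = \<zero>\<^bsub>V\<^esub>"

locale real_hilbert_space = real_inner_product_space V ip
  for V :: "(real, 'h) module" and ip :: "'h \<Rightarrow> 'h \<Rightarrow> real" +
  assumes complete: "Metric_space.mcomplete (carrier V) (ip_dist V ip)"

context real_inner_product_space
begin

lemma ip_add_right:
  "\<lbrakk>x \<in> carrier V; y \<in> carrier V; z \<in> carrier V\<rbrakk> \<Longrightarrow> ip z (x \<oplus>\<^bsub>V\<^esub> y) = ip z x + ip z y"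
  using ip_add_left[of x y z] ip_commute[of z] M.a_closed[of x y] by simp

lemma ip_smult_right:
  "\<lbrakk>x \<in> carrier V; y \<in> carrier V\<rbrakk> \<Longrightarrow> ip y (a \<odot>\<^bsub>V\<^esub> x) = a * ip y x"
  using ip_smult_left[of x y a] ip_commute[of y] smult_closed[of a x] by (simp add: real_ring_def)

lemma ip_zero_left: "y \<in> carrier V \<Longrightarrow> ip \<zero>\<^bsub>V\<^esub> y = 0"
  using ip_add_left[of "\<zero>\<^bsub>V\<^esub>" "\<zero>\<^bsub>V\<^esub>" y] by simp

lemma ip_expand:
  assumes "x \<in> carrier V" "y \<in> carrier V"
  shows "ip (x \<oplus>\<^bsub>V\<^esub> a \<odot>\<^bsub>V\<^esub> y) (x \<oplus>\<^bsub>V\<^esub> a \<odot>\<^bsub>V\<^esub> y) = ip x x + 2 * a * ip x y + a\<^sup>2 * ip y y"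
proof -
  have ay: "a \<odot>\<^bsub>V\<^esub> y \<in> carrier V"
    using smult_closed[of a y] assms by (simp add: real_ring_def)
  show ?thesis
    using assms ay ip_commute[of x y]
    by (simp add: ip_add_left ip_add_right ip_smult_left ip_smult_right power2_eq_square
        algebra_simps)
qed

lemma ip_Cauchy_Schwarz:
  assumes "x \<in> carrier V" "y \<in> carrier V"
  shows "ip x y \<le> sqrt (ip x x) * sqrt (ip y y)"
proof (cases "ip y y = 0")
  case True
  then have "y = \<zero>\<^bsub>V\<^esub>" using ip_eq_zero assms by auto
  then show ?thesis using ip_zero_left[of x] ip_commute[of x y] assms ip_nonneg by auto
next
  case False
  then have pos: "ip y y > 0" using ip_nonneg[of y] assms by simp
  let ?a = "- (ip x y / ip y y)"
  have "?a \<odot>\<^bsub>V\<^esub> y \<in> carrier V"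
    using smult_closed[of ?a y] assms by (simp add: real_ring_def)
  then have "0 \<le> ip x x + 2 * ?a * ip x y + ?a\<^sup>2 * ip y y"
    using ip_expand[OF assms, of ?a] ip_nonneg[of "x \<oplus>\<^bsub>V\<^esub> ?a \<odot>\<^bsub>V\<^esub> y"] assms by auto
  then have "(ip x y)\<^sup>2 \<le> ip x x * ip y y"
    using pos by (simp add: power2_eq_square field_simps)
  then have "\<bar>ip x y\<bar> \<le> sqrt (ip x x * ip y y)" by (simp add: real_le_rsqrt)
  then show ?thesis by (simp add: real_sqrt_mult)
qed

lemma ip_Metric_space: "Metric_space (carrier V) (ip_dist V ip)"
proof
  fix x y
  show "0 \<le> ip_dist V ip x y" by (simp add: ip_dist_def ip_nonneg)
  show "ip_dist V ip x y = ip_dist V ip y x"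
  proof (cases "x \<in> carrier V \<and> y \<in> carrier V")
    case True
    let ?u = "x \<ominus>\<^bsub>V\<^esub> y" let ?v = "y \<ominus>\<^bsub>V\<^esub> x"
    have c: "?u \<in> carrier V" "?v \<in> carrier V" using True by auto
    have "?u \<oplus>\<^bsub>V\<^esub> ?v = \<zero>\<^bsub>V\<^esub>"
      using True by (simp add: M.minus_eq M.a_ac M.r_neg M.r_neg1 M.r_neg2)
    then have "ip ?u ?u + ip ?v ?u = 0" "ip ?u ?v + ip ?v ?v = 0"
      using ip_add_left[OF c, of ?u] ip_add_left[OF c, of ?v] c ip_zero_left by auto
    then show ?thesis using True ip_commute[OF c] by (simp add: ip_dist_def)
  qed (auto simp: ip_dist_def)
next
  fix x y assume xy: "x \<in> carrier V" "y \<in> carrier V"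
  then have "ip_dist V ip x y = 0 \<longleftrightarrow> x \<ominus>\<^bsub>V\<^esub> y = \<zero>\<^bsub>V\<^esub>"
    using ip_eq_zero[of "x \<ominus>\<^bsub>V\<^esub> y"] ip_zero_left[of "\<zero>\<^bsub>V\<^esub>"] by (auto simp: ip_dist_def)
  moreover have "x = (x \<ominus>\<^bsub>V\<^esub> y) \<oplus>\<^bsub>V\<^esub> y"
    using xy by (simp add: M.minus_eq M.a_assoc M.l_neg)
  moreover have "x \<ominus>\<^bsub>V\<^esub> x = \<zero>\<^bsub>V\<^esub>"
    using xy by (simp add: M.minus_eq M.r_neg)
  ultimately show "ip_dist V ip x y = 0 \<longleftrightarrow> x = y" using xy by (metis M.l_zero)
next
  fix x y z assume xyz: "x \<in> carrier V" "y \<in> carrier V" "z \<in> carrier V"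
  let ?u = "x \<ominus>\<^bsub>V\<^esub> y" let ?v = "y \<ominus>\<^bsub>V\<^esub> z"
  have c: "?u \<in> carrier V" "?v \<in> carrier V" using xyz by auto
  have s: "x \<ominus>\<^bsub>V\<^esub> z = ?u \<oplus>\<^bsub>V\<^esub> ?v"
    using xyz by (simp add: M.minus_eq M.a_assoc M.r_neg1)
  have "ip (?u \<oplus>\<^bsub>V\<^esub> ?v) (?u \<oplus>\<^bsub>V\<^esub> ?v) = ip ?u ?u + 2 * ip ?u ?v + ip ?v ?v"
    using c ip_commute[OF c] by (simp add: ip_add_left ip_add_right)
  also have "\<dots> \<le> (sqrt (ip ?u ?u) + sqrt (ip ?v ?v))\<^sup>2"
    using ip_Cauchy_Schwarz[OF c] ip_nonneg c by (simp add: power2_sum)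
  finally have "sqrt (ip (?u \<oplus>\<^bsub>V\<^esub> ?v) (?u \<oplus>\<^bsub>V\<^esub> ?v)) \<le> sqrt (ip ?u ?u) + sqrt (ip ?v ?v)"
    using ip_nonneg c by (simp add: real_le_lsqrt)
  then show "ip_dist V ip x z \<le> ip_dist V ip x y + ip_dist V ip y z"
    using xyz s by (simp add: ip_dist_def)
qed

end


subsection \<open>Kazhdan and Haagerup groups\<close>

text \<open>HOL cannot quantify over types, so "every Hilbert space" means every Hilbert space whose
  carrier is a set in the type \<open>'h\<close>, which acts as the universe. The theorem is stated for every
  \<open>'h\<close> with at least continuum many elements; some such bound is needed, since a smaller type
  carries only the zero space.\<close>

definition kazhdan_group :: "'h itself \<Rightarrow> ('g, 'b) monoid_scheme \<Rightarrow> bool" where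
  "kazhdan_group (_ :: 'h itself) G \<longleftrightarrow>
    (\<forall>(V :: (real, 'h) module) ip \<phi>.
      real_hilbert_space V ip \<and> isometric_action G (carrier V) (ip_dist V ip) \<phi> \<longrightarrow>
      (\<exists>v \<in> carrier V. \<forall>g \<in> carrier G. \<phi> g v = v))"

definition haagerup_group :: "'h itself \<Rightarrow> ('g, 'b) monoid_scheme \<Rightarrow> bool" where
  "haagerup_group (_ :: 'h itself) G \<longleftrightarrow>
    (\<exists>(V :: (real, 'h) module) ip \<phi>.
      real_hilbert_space V ip \<and> isometric_action G (carrier V) (ip_dist V ip) \<phi> \<and>
      proper_action G (carrier V) (ip_dist V ip) \<phi>)"

end

theory Submission
  imports Defs "HOL-Library.Function_Algebras"
begin

text \<open>Fix a base point of a median space and order the space by \<open>x \<le> y\<close> iff \<open>x\<close> lies on a geodesic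
  from the base point to \<open>y\<close>. Medians with the base point are meets, bounded finite sets have joins,
  meets distribute over them, and the distance to the base point is a valuation. Hence on a finite
  meet-closed set it is the sum over down-sets of a nonnegative density, so that the Gromov product
  is positive definite and the metric is conditionally negative definite. Pulled back to \<open>G\<close> along an
  orbit, the metric thus gives an affine isometric action of \<open>G\<close> on a Hilbert space in which the
  squared displacement of the origin by \<open>g\<close> is the displacement of the base point by \<open>g\<close>.\<close>

section \<open>Median metrics are conditionally negative definite\<close>

text \<open>A finite set of points rarely contains the joins of its down-sets. So it is closed under
  meets only, joins are taken in the whole space, and the density is a Moebius inversion over
  down-sets. Its existence needs meets to distribute over joins, and this has to be extracted from
  uniqueness of medians. On the Hilbert side, quotient and completion of the finitely supported
  functions are avoided: their dual is realised as a space of functions on \<open>G\<close>. Null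
  vectors of the form then do no harm, completeness follows from pointwise limits, and countability
  of \<open>G\<close> leaves at most continuum many functions, so that the space fits into
  \<open>'h\<close>.\<close>

context median_space
begin

section \<open>Medians as meets in the order based at a point\<close>

abbreviation I where "I \<equiv> geodesic_interval X d"

definition med where
  "med x y z = (THE t. t \<in> I x y \<inter> I y z \<inter> I z x)"

lemma interval_iff: "t \<in> I x y \<longleftrightarrow> t \<in> X \<and> d x t + d t y = d x y"
  by (simp add: geodesic_interval_def)

lemma interval_commute: "I x y = I y x"
  by (auto simp: interval_iff commute add.commute)

lemma interval_in_X: "t \<in> I x y \<Longrightarrow> t \<in> X"
  by (simp add: interval_iff)

lemma endpoints_in_interval:
  assumes "x \<in> X" "y \<in> X"
  shows "x \<in> I x y" "y \<in> I x y"
  using assms by (simp_all add: interval_iff)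

lemma med_in_intervals:
  assumes "x \<in> X" "y \<in> X" "z \<in> X"
  shows "med x y z \<in> I x y" "med x y z \<in> I y z" "med x y z \<in> I x z" "med x y z \<in> X"
  using theI'[OF unique_median[OF assms]] unfolding med_def
  by (auto simp: interval_commute[of z x] interval_in_X)

lemma med_unique:
  assumes "x \<in> X" "y \<in> X" "z \<in> X" "t \<in> I x y" "t \<in> I y z" "t \<in> I x z"
  shows "t = med x y z"
  using unique_median[OF assms(1-3)] med_in_intervals[OF assms(1-3)] assms(4-6)
  by (metis IntI interval_commute)

lemma geodesic_chain:
  assumes "p \<in> X" "z \<in> X" "y \<in> I p z" "x \<in> I p y"
  shows "x \<in> I p z" "y \<in> I x z"
proof -
  have "x \<in> X" "y \<in> X" using assms by (auto simp: interval_iff)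
  then show "x \<in> I p z" "y \<in> I x z"
    using assms triangle[of p x z] triangle[of x y z] by (auto simp: interval_iff)
qed

lemma geodesic_chain':
  assumes "p \<in> X" "z \<in> X" "x \<in> I p z" "y \<in> I x z"
  shows "y \<in> I p z" "x \<in> I p y"
proof -
  have "x \<in> X" "y \<in> X" using assms by (auto simp: interval_iff)
  then show "y \<in> I p z" "x \<in> I p y"
    using assms triangle[of p y z] triangle[of p x y] by (auto simp: interval_iff)
qed

lemma interval_antisym:
  assumes "p \<in> X" "x \<in> I p y" "y \<in> I p x"
  shows "x = y"
proof -
  have "x \<in> X" "y \<in> X" using assms by (auto simp: interval_iff)
  moreover have "d x y = 0"
    using assms(2,3) nonneg[of x y] commute[of x y] unfolding interval_iff by linarith
  ultimately show ?thesis by simp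
qed

lemma interval_eq_of_dist:
  assumes "x \<in> I p y" "y \<in> X" "d p x = d p y"
  shows "x = y"
  using assms by (auto simp: interval_iff)

lemma med_commute: "\<lbrakk>p \<in> X; x \<in> X; y \<in> X\<rbrakk> \<Longrightarrow> med p x y = med p y x"
  by (rule med_unique) (auto simp: med_in_intervals interval_commute)

lemma med_eq_left:
  assumes "p \<in> X" "y \<in> X" "x \<in> I p y"
  shows "med p x y = x"
proof -
  have "x \<in> X" using assms by (simp add: interval_iff)
  then show ?thesis
    using med_unique[of p x y x] assms endpoints_in_interval by auto
qed

text \<open>The meet lies on all three sides; combining the three equalities leaves twice the Gromov
  product, which ties the order to the metric.\<close>

lemma dist_med:
  assumes "p \<in> X" "x \<in> X" "y \<in> X"
  shows "2 * d p (med p x y) = d p x + d p y - d x y"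
  using med_in_intervals[OF assms] commute[of x "med p x y"]
  by (auto simp: interval_iff)

text \<open>The median of \<open>w\<close>, \<open>x\<close>, \<open>y\<close> lies beyond
  \<open>w\<close> on the way to both \<open>x\<close> and \<open>y\<close>, hence between
  \<open>p\<close> and either of them; uniqueness identifies it with
  \<open>med p x y\<close>.\<close>

lemma med_greatest:
  assumes "p \<in> X" "x \<in> X" "y \<in> X" "w \<in> I p x" "w \<in> I p y"
  shows "w \<in> I p (med p x y)"
proof -
  have w: "w \<in> X" using assms by (simp add: interval_iff)
  let ?m = "med w x y"
  note m = med_in_intervals[OF w assms(2,3)]
  have 1: "?m \<in> I p x" "w \<in> I p ?m"
    using geodesic_chain'[OF assms(1,2,4) m(1)] by auto
  have 2: "?m \<in> I p y" using geodesic_chain'[OF assms(1,3,5) m(3)] by auto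
  show ?thesis using med_unique[OF assms(1-3) 1(1) m(2) 2] 1(2) by simp
qed

lemma med_mono:
  assumes "p \<in> X" "x \<in> X" "y \<in> X" "w \<in> I p y"
  shows "med p x w \<in> I p (med p x y)"
proof (rule med_greatest[OF assms(1-3)])
  have w: "w \<in> X" using assms by (simp add: interval_iff)
  show "med p x w \<in> I p x" using med_in_intervals[OF assms(1,2) w] by auto
  show "med p x w \<in> I p y"
    using geodesic_chain(1)[OF assms(1,3,4)] med_in_intervals[OF assms(1,2) w] by auto
qed

lemma med_assoc:
  assumes "p \<in> X" "x \<in> X" "y \<in> X" "z \<in> X"
  shows "med p (med p x y) z = med p x (med p y z)"
proof (rule interval_antisym[OF assms(1)])
  note yz = med_in_intervals[OF assms(1,3,4)] and xy = med_in_intervals[OF assms(1,2,3)]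
  note l = med_in_intervals[OF assms(1) xy(4) assms(4)]
  note r = med_in_intervals[OF assms(1,2) yz(4)]
  show "med p (med p x y) z \<in> I p (med p x (med p y z))"
    by (intro med_greatest assms yz l
        geodesic_chain(1)[OF assms(1,2) xy(1) l(1)] geodesic_chain(1)[OF assms(1,3) xy(3) l(1)])
  show "med p x (med p y z) \<in> I p (med p (med p x y) z)"
    by (intro med_greatest assms xy r
        geodesic_chain(1)[OF assms(1,3) yz(1) r(3)] geodesic_chain(1)[OF assms(1,4) yz(3) r(3)])
qed

lemma med_idem: "\<lbrakk>p \<in> X; x \<in> X\<rbrakk> \<Longrightarrow> med p x x = x"
  by (simp add: med_eq_left endpoints_in_interval)

section \<open>Joins of bounded pairs and the valuation\<close>

lemma join_upper:
  assumes "p \<in> X" "z \<in> X" "a \<in> I p z" "b \<in> I p z"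
  shows "a \<in> I p (med a b z)" "b \<in> I p (med a b z)" "med a b z \<in> I p z"
proof -
  have ab: "a \<in> X" "b \<in> X" using assms by (auto simp: interval_iff)
  note m = med_in_intervals[OF ab assms(2)]
  show "a \<in> I p (med a b z)" "b \<in> I p (med a b z)" "med a b z \<in> I p z"
    using geodesic_chain'[OF assms(1,2,3) m(3)] geodesic_chain'[OF assms(1,2,4) m(2)] by auto
qed

text \<open>Computed below the smaller bound \<open>med p z w\<close>, the join still lies on
  geodesics from \<open>a\<close> and \<open>b\<close> to \<open>z\<close>, so uniqueness gives the
  same point, which is then below \<open>w\<close>.\<close>

lemma join_least:
  assumes "p \<in> X" "z \<in> X" "a \<in> I p z" "b \<in> I p z" "w \<in> X" "a \<in> I p w" "b \<in> I p w"
  shows "med a b z \<in> I p w"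
proof -
  have ab: "a \<in> X" "b \<in> X" using assms by (auto simp: interval_iff)
  let ?u = "med p z w"
  note u = med_in_intervals[OF assms(1,2,5)]
  have au: "a \<in> I p ?u" and bu: "b \<in> I p ?u" using med_greatest assms by auto
  let ?j = "med a b ?u"
  note j = med_in_intervals[OF ab u(4)]
  have "?j \<in> I a z" "?j \<in> I b z"
    using geodesic_chain(1)[OF _ assms(2) geodesic_chain(2)[OF assms(1,2) u(1) au] j(3)]
      geodesic_chain(1)[OF _ assms(2) geodesic_chain(2)[OF assms(1,2) u(1) bu] j(2)] ab by auto
  then have "?j = med a b z" using med_unique[OF ab assms(2) j(1)] by auto
  then have "med a b z \<in> I p ?u" using join_upper(3)[OF assms(1) u(4) au bu] by simp
  then show ?thesis using geodesic_chain(1)[OF assms(1,5) u(3)] by auto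
qed

text \<open>The join lies between \<open>a\<close> and \<open>b\<close>, so twice its height is
  \<open>d p a + d p b + d a b\<close>; for the meet the last sign is reversed.\<close>

lemma dist_join:
  assumes "p \<in> X" "z \<in> X" "a \<in> I p z" "b \<in> I p z"
  shows "d p (med a b z) + d p (med p a b) = d p a + d p b"
proof -
  have ab: "a \<in> X" "b \<in> X" using assms by (auto simp: interval_iff)
  show ?thesis
    using join_upper[OF assms] med_in_intervals(1)[OF ab assms(2)] dist_med[OF assms(1) ab]
      commute[of b "med a b z"]
    by (auto simp: interval_iff)
qed

text \<open>The join of the meets of \<open>t\<close> with \<open>a\<close> and \<open>b\<close>, taken in the order based at \<open>c\<close>, lies in
  all three intervals and is therefore the median.\<close>

lemma med_gate:
  assumes "a \<in> X" "b \<in> X" "t \<in> X" "c \<in> I a b"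
  shows "med a b t \<in> I c t"
proof -
  have c: "c \<in> X" using assms by (simp add: interval_iff)
  \<comment> \<open>As \<open>c\<close> lies between \<open>a\<close> and \<open>b\<close>, their
    meet based at \<open>c\<close> is \<open>c\<close> itself, and so is any meet across the two
    branches; heights of such joins add.\<close>
  have disj: "d c (med c x y) = 0" if "x \<in> I c a" "y \<in> I c b" for x y
  proof -
    have xy: "x \<in> X" "y \<in> X" using that by (auto simp: interval_iff)
    have "med c x y \<in> I c a" "med c x y \<in> I c b"
      using geodesic_chain(1)[OF c assms(1) that(1)] geodesic_chain(1)[OF c assms(2) that(2)]
        med_in_intervals[OF c xy] by auto
    then have "med c x y \<in> I c (med c a b)" using med_greatest c assms by auto
    moreover have "d c (med c a b) = 0"
      using dist_med[OF c assms(1,2)] assms(4) commute by (simp add: interval_iff)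
    ultimately show ?thesis
      using nonneg[of c "med c x y"] nonneg[of "med c x y" "med c a b"]
      unfolding interval_iff by linarith
  qed
  define \<alpha> where "\<alpha> = med c a t"
  define \<beta> where "\<beta> = med c b t"
  note \<alpha> = med_in_intervals[OF c assms(1,3), folded \<alpha>_def]
    and \<beta> = med_in_intervals[OF c assms(2,3), folded \<beta>_def]
  define l where "l = med \<alpha> \<beta> t"
  note l = join_upper[OF c assms(3) \<alpha>(3) \<beta>(3), folded l_def]
  have lX: "l \<in> X" using l by (simp add: interval_iff)
  note al = med_in_intervals[OF c assms(1) lX] and bl = med_in_intervals[OF c assms(2) lX]
  have ge: "d c \<alpha> \<le> d c (med c a l)" "d c \<beta> \<le> d c (med c b l)"
    using med_greatest[OF c assms(1) lX \<alpha>(1) l(1)] med_greatest[OF c assms(2) lX \<beta>(1) l(2)]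
      nonneg by (auto simp: interval_iff) (metis add_increasing2 le_add_same_cancel1 nonneg)+
  have r: "d c l = d c \<alpha> + d c \<beta>"
    using dist_join[OF c assms(3) \<alpha>(3) \<beta>(3)] disj[OF \<alpha>(1) \<beta>(1)] by (simp add: l_def)
  have "d c (med c a l) + d c (med c b l) \<le> d c l"
    using dist_join[OF c lX al(3) bl(3)] disj[OF al(1) bl(1)] join_upper(3)[OF c lX al(3) bl(3)]
      nonneg[of "med (med c a l) (med c b l) l" l] unfolding interval_iff by linarith
  \<comment> \<open>The meets of \<open>l\<close> with \<open>a\<close> and \<open>b\<close> are at
    least as high as \<open>\<alpha>\<close> and \<open>\<beta>\<close>, but together at most as
    high as \<open>l\<close>, whose height is the sum of those two. With \<open>dist_med\<close>
    this fixes the distances from \<open>l\<close> to \<open>a\<close> and \<open>b\<close>.\<close>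
  then have eq: "d c (med c a l) = d c \<alpha>" "d c (med c b l) = d c \<beta>"
    using ge r by linarith+
  have "l \<in> I a b" "l \<in> I b t" "l \<in> I a t"
    using r eq dist_med[OF c assms(1) lX] dist_med[OF c assms(2) lX] lX assms(4) l(3)
      dist_med[OF c assms(1,3)] dist_med[OF c assms(2,3)] commute[of c a] commute[of b l]
    by (auto simp: interval_iff \<alpha>_def \<beta>_def)
  then have "l = med a b t" using med_unique assms by blast
  then show ?thesis using l by simp
qed

section \<open>Finite joins and distributivity\<close>

definition is_join where
  "is_join p D j \<longleftrightarrow> j \<in> X \<and> (\<forall>x \<in> D. x \<in> I p j) \<and>
     (\<forall>w \<in> X. (\<forall>x \<in> D. x \<in> I p w) \<longrightarrow> j \<in> I p w)"

lemma is_joinD: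
  assumes "is_join p D j"
  shows "j \<in> X" "x \<in> D \<Longrightarrow> x \<in> I p j" "\<lbrakk>w \<in> X; \<And>x. x \<in> D \<Longrightarrow> x \<in> I p w\<rbrakk> \<Longrightarrow> j \<in> I p w"
  using assms by (auto simp: is_join_def)

lemma is_join_unique: "\<lbrakk>p \<in> X; is_join p D j; is_join p D j'\<rbrakk> \<Longrightarrow> j = j'"
  by (meson interval_antisym is_joinD)

lemma is_join_med:
  assumes "p \<in> X" "z \<in> X" "a \<in> I p z" "b \<in> I p z"
  shows "is_join p {a, b} (med a b z)"
  using join_upper[OF assms] join_least[OF assms] by (auto simp: is_join_def interval_in_X)

lemma is_join_insert:
  assumes "p \<in> X" "is_join p D j" "is_join p {j, x} j'"
  shows "is_join p (insert x D) j'"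
proof -
  have "y \<in> I p j'" if "y \<in> D" for y
    using that geodesic_chain(1)[OF assms(1), of j' j y] assms(2,3) by (auto simp: is_join_def)
  then show ?thesis using assms by (auto simp: is_join_def)
qed

text \<open>The bound \<open>z\<close> matters: two branches of a tree have no common upper bound.
  Hence \<open>is_join\<close> is a relation and not an operation.\<close>

lemma is_join_exists:
  assumes "p \<in> X" "finite D" "z \<in> X" "\<And>x. x \<in> D \<Longrightarrow> x \<in> I p z"
  obtains j where "is_join p D j"
  using assms(2,4)
proof (induction D arbitrary: thesis rule: finite_induct)
  case empty
  have "is_join p {} p" using assms(1) by (auto simp: is_join_def endpoints_in_interval)
  then show ?case by (rule empty)
next
  case (insert x D)
  then obtain j where j: "is_join p D j" by auto
  have "j \<in> I p z" using is_joinD(3)[OF j assms(3)] insert.prems by auto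
  then have "is_join p {j, x} (med j x z)" using is_join_med assms insert.prems by auto
  then show ?case using is_join_insert[OF assms(1) j] insert.prems by auto
qed

text \<open>Distributivity. With \<open>s = med p q j\<close>, the join \<open>u\<close> of the two
  meets is below \<open>s\<close>, so it suffices to compare heights. The distances come from
  \<open>n = med a b s\<close>: \<open>med_gate\<close> puts it between \<open>s\<close> and
  \<open>j\<close>, hence above \<open>s\<close>, and also between \<open>s\<close> and
  \<open>c\<close>, the meet of \<open>a\<close> and \<open>b\<close>.\<close>

lemma is_join_pair_med:
  assumes p: "p \<in> X" and "q \<in> X" "a \<in> X" "b \<in> X" and j: "is_join p {a, b} j"
  shows "is_join p {med p q a, med p q b} (med p q j)"
proof -
  have jX: "j \<in> X" and aj: "a \<in> I p j" and bj: "b \<in> I p j" using is_joinD[OF j] by auto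
  have j_eq: "j = med a b j" using is_join_unique[OF p j is_join_med[OF p jX aj bj]] .
  have jab: "j \<in> I a b" using j_eq med_in_intervals(1)[OF assms(3,4) jX] by simp
  define s where "s = med p q j"
  note s = med_in_intervals[OF p assms(2) jX, folded s_def]
  have sX: "s \<in> X" using s by simp
  have sm: "med p s x = med p q x" if "x \<in> I p j" for x
  proof -
    have "x \<in> X" using that by (simp add: interval_iff)
    then show ?thesis
      using med_assoc[OF p assms(2) jX, of x] med_eq_left[OF p jX that] med_commute[OF p jX, of x]
      by (simp add: s_def)
  qed
  note sa = med_in_intervals[OF p sX assms(3)] and sb = med_in_intervals[OF p sX assms(4)]
  define u where "u = med (med p s a) (med p s b) s"
  note u = join_upper[OF p sX sa(1) sb(1), folded u_def]
  define c where "c = med p a b"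
  note c = med_in_intervals[OF p assms(3,4), folded c_def]
  define n where "n = med a b s"
  note n = med_in_intervals[OF assms(3,4) sX, folded n_def]
  have nj: "n \<in> I j s" and nc: "n \<in> I c s"
    using med_gate[OF assms(3,4) sX] jab c(2) by (auto simp: n_def)
  \<comment> \<open>Here \<open>n\<close> is the gate point and \<open>p\<close> the target: the
    median of \<open>a\<close>, \<open>b\<close>, \<open>p\<close> is \<open>c\<close>, so
    \<open>c\<close> lies between \<open>n\<close> and \<open>p\<close>.\<close>
  have cn: "c \<in> I p n"
    using med_gate[OF assms(3,4) p n(1)] med_unique[OF p assms(3,4) c(1,2,3)]
      med_unique[OF assms(3,4) p, of c] c interval_commute by metis
  have sn: "s \<in> I p n"
    using geodesic_chain'(2)[OF p jX s(3)] nj interval_commute by metis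
  have cab: "med p s c \<in> I p (med p (med p s a) (med p s b))"
    using med_mono[OF p sX assms(3) c(1)] med_mono[OF p sX assms(4) c(3)] med_greatest[OF p sa(4) sb(4)]
    by auto
  have "d p s + d p (med p s c) = d p (med p s a) + d p (med p s b)"
    using cn sn dist_med[OF p sX c(4)] dist_med[OF p sX assms(3)] dist_med[OF p sX assms(4)]
      n(1,2,3) nc dist_med[OF p assms(3,4)] commute[of c s] commute[of a s] commute[of b s]
      commute[of a n] commute[of b n] commute[of c n] commute[of s n]
    by (auto simp: interval_iff c_def)
  moreover have "d p u + d p (med p (med p s a) (med p s b)) = d p (med p s a) + d p (med p s b)"
    using dist_join[OF p sX sa(1) sb(1)] by (simp add: u_def)
  moreover have "med p s c = med p (med p s a) (med p s b)"
  proof (rule interval_antisym[OF p cab])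
    note w = med_in_intervals[OF p sa(4) sb(4)]
    have "med p (med p s a) (med p s b) \<in> I p a" "med p (med p s a) (med p s b) \<in> I p b"
      "med p (med p s a) (med p s b) \<in> I p s"
      using geodesic_chain(1)[OF p assms(3) sa(3) w(1)] geodesic_chain(1)[OF p assms(4) sb(3) w(3)]
        geodesic_chain(1)[OF p sX sa(1) w(1)] by auto
    then show "med p (med p s a) (med p s b) \<in> I p (med p s c)"
      using med_greatest p sX c(4) assms(3,4) by (auto simp: c_def)
  qed
  ultimately have "d p u = d p s" by simp
  then have "u = s" using interval_eq_of_dist u(3) sX by auto
  then show ?thesis
    using is_join_med[OF p sX sa(1) sb(1)] sm[OF aj] sm[OF bj] by (simp add: u_def s_def)
qed

lemma is_join_image_med:
  assumes "p \<in> X" "q \<in> X" "finite D" "is_join p D j"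
  shows "is_join p (med p q ` D) (med p q j)"
  using assms(3,4)
proof (induction D arbitrary: j rule: finite_induct)
  case empty
  have "is_join p {} p" using assms(1) by (auto simp: is_join_def endpoints_in_interval)
  moreover have "med p q p = p"
    using assms(1,2) by (metis endpoints_in_interval(1) med_commute med_eq_left)
  ultimately show ?case using is_join_unique[OF assms(1)] empty by fastforce
next
  case (insert x D)
  have j: "j \<in> X" "x \<in> I p j" "x \<in> X" using is_joinD[OF insert.prems] by (auto simp: interval_iff)
  obtain j' where j': "is_join p D j'"
    using is_join_exists[OF assms(1) insert.hyps(1) j(1)] is_joinD(2)[OF insert.prems] by auto
  have j'j: "j' \<in> I p j" using is_joinD(3)[OF j' j(1)] is_joinD(2)[OF insert.prems] by auto
  have pair: "is_join p {j', x} (med j' x j)" using is_join_med assms(1) j j'j by auto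
  then have eq: "j = med j' x j"
    by (rule is_join_unique[OF assms(1) insert.prems is_join_insert[OF assms(1) j']])
  have "is_join p {med p q j', med p q x} (med p q j)"
    using is_join_pair_med[OF assms(1,2) is_joinD(1)[OF j'] j(3) pair[folded eq]] .
  then show ?case
    using is_join_insert[OF assms(1) insert.IH[OF j']] by auto
qed

section \<open>The density of the valuation on a finite meet-closed set\<close>

definition is_join_density where
  "is_join_density p A f \<longleftrightarrow> (\<forall>x\<in>A. 0 \<le> f x) \<and>
    (\<forall>D j. D \<subseteq> A \<longrightarrow> (\<forall>x\<in>D. \<forall>y\<in>A. y \<in> I p x \<longrightarrow> y \<in> D) \<longrightarrow> is_join p D j \<longrightarrow> d p j = sum f D)"

lemma is_join_densityD:
  assumes "is_join_density p A f"
  shows "x \<in> A \<Longrightarrow> 0 \<le> f x"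
    and "\<lbrakk>D \<subseteq> A; \<And>x y. \<lbrakk>x \<in> D; y \<in> A; y \<in> I p x\<rbrakk> \<Longrightarrow> y \<in> D; is_join p D j\<rbrakk> \<Longrightarrow> d p j = sum f D"
  using assms by (auto simp: is_join_density_def)

text \<open>Moebius inversion along increasing height. The claim ranges over all down-sets, since
  deleting the greatest point of a principal one leaves a general one. When \<open>z\<close> joins a
  down-set, distributivity turns the meet of \<open>z\<close> with the previous join into the join
  of \<open>B\<close>, and the valuation gives the increment.\<close>

lemma is_join_density_exists:
  assumes p: "p \<in> X" and "finite A" "A \<subseteq> X" "\<And>x y. \<lbrakk>x \<in> A; y \<in> A\<rbrakk> \<Longrightarrow> med p x y \<in> A"
  shows "\<exists>f. is_join_density p A f"
  using assms(2-)
proof (induction A rule: finite_ranking_induct[where f = "d p"])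
  case empty
  have "is_join p {} p" using assms(1) by (auto simp: is_join_def endpoints_in_interval)
  then have "d p j = 0" if "is_join p {} j" for j using is_join_unique[OF p that] p by auto
  then show ?case by (auto simp: is_join_density_def)
next
  case (insert z A)
  show ?case
  proof (cases "z \<in> A")
    case True
    then have "insert z A = A" by auto
    then show ?thesis using insert.IH insert.prems by (simp only:)
  next
    case False
    have zX: "z \<in> X" and AX: "A \<subseteq> X" using insert.prems by auto
    \<comment> \<open>The ranking induction adds a point of largest height, so it lies below no
      earlier point.\<close>
    have max: "z \<notin> I p y" if "y \<in> A" for y
    proof
      assume "z \<in> I p y"
      then have "d z y = 0"
        using insert.hyps(2)[OF that] nonneg[of z y] unfolding interval_iff by linarith
      then have "z = y" using that AX zX by auto
      then show False using that False by simp
    qed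
    have clA: "med p x y \<in> A" if "x \<in> A" "y \<in> A" for x y
    proof -
      have "med p x y \<in> I p x" using med_in_intervals(1) p that AX by auto
      then show ?thesis using insert.prems(2)[of x y] max that by auto
    qed
    obtain f where f: "is_join_density p A f" using insert.IH[OF AX clA] by auto
    note fD = is_join_densityD(2)[OF f]
    define B where "B = {y \<in> A. y \<in> I p z}"
    have "finite B" using insert.hyps by (simp add: B_def)
    then obtain b where b: "is_join p B b"
      using is_join_exists[OF p _ zX] by (auto simp: B_def)
    have bz: "b \<in> I p z" using is_joinD(3)[OF b zX] by (auto simp: B_def)
    have fB: "d p b = sum f B"
    proof (rule fD[OF _ _ b])
      show "y \<in> B" if "x \<in> B" "y \<in> A" "y \<in> I p x" for x y
        using that geodesic_chain(1)[OF p zX, of x y] by (simp add: B_def)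
    qed (simp add: B_def)
    \<comment> \<open>The mass of \<open>z\<close> is the rise in height from the join of the
      earlier points below it.\<close>
    define g where "g = f(z := d p z - d p b)"
    have gf: "sum g D = sum f D" if "D \<subseteq> A" for D
      using that False by (intro sum.cong) (auto simp: g_def)
    show ?thesis
      unfolding is_join_density_def
    proof (intro exI[of _ g] conjI ballI allI impI)
      fix x assume "x \<in> insert z A"
      moreover have "d p b \<le> d p z" using bz nonneg[of b z] unfolding interval_iff by linarith
      ultimately show "0 \<le> g x" using is_join_densityD(1)[OF f] by (auto simp: g_def)
    next
      fix D j
      assume D: "D \<subseteq> insert z A" and "\<forall>x\<in>D. \<forall>y\<in>insert z A. y \<in> I p x \<longrightarrow> y \<in> D"
        and j: "is_join p D j"
      then have down: "\<And>x y. \<lbrakk>x \<in> D; y \<in> insert z A; y \<in> I p x\<rbrakk> \<Longrightarrow> y \<in> D" by blast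
      show "d p j = sum g D"
      proof (cases "z \<in> D")
        case False
        then have "D \<subseteq> A" using D by auto
        then show ?thesis using fD[OF _ _ j] down gf by auto
      next
        case zD: True
        define D' where "D' = D - {z}"
        have D': "D' \<subseteq> A" "finite D'" using D insert.hyps(1) by (auto simp: D'_def intro: finite_subset)
        have DD': "D = insert z D'" using zD by (auto simp: D'_def)
        have down': "y \<in> D'" if "x \<in> D'" "y \<in> A" "y \<in> I p x" for x y
          using that down[of x y] False by (auto simp: D'_def)
        have jX: "j \<in> X" using is_joinD[OF j] by auto
        obtain j' where j': "is_join p D' j'"
          using is_join_exists[OF p D'(2) jX] is_joinD(2)[OF j] by (auto simp: D'_def)
        have j'j: "j' \<in> I p j" using is_joinD(3)[OF j' jX] is_joinD(2)[OF j] by (auto simp: D'_def)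
        have zj: "z \<in> I p j" using is_joinD(2)[OF j zD] .
        have j_eq: "med j' z j = j"
          using is_join_unique[OF p is_join_insert[OF p j' is_join_med[OF p jX j'j zj]]] j DD' by simp
        then have val: "d p j + d p (med p j' z) = d p j' + d p z"
          using dist_join[OF p jX j'j zj] by simp
        \<comment> \<open>Meets with \<open>z\<close> stay in \<open>A\<close>, since maximality
          rules out \<open>z\<close> itself. Conversely, \<open>D\<close> is a down-set containing
          \<open>z\<close>, so it contains \<open>B\<close>, on which the meet with \<open>z\<close>
          is the identity.\<close>
        have img: "med p z ` D' = B"
        proof
          show "med p z ` D' \<subseteq> B"
          proof
            fix t assume "t \<in> med p z ` D'"
            then obtain x where x: "x \<in> D'" "t = med p z x" by auto
            then have xA: "x \<in> A" using D' by auto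
            have m: "med p z x \<in> I p z" "med p z x \<in> I p x" using med_in_intervals p zX xA AX by auto
            then have "med p z x \<noteq> z" using max[OF xA] by metis
            then show "t \<in> B" using m insert.prems(2)[of z x] xA x by (auto simp: B_def)
          qed
          show "B \<subseteq> med p z ` D'"
          proof
            fix y assume y: "y \<in> B"
            then have "y \<in> D'" using down[OF zD] False by (auto simp: B_def D'_def)
            moreover have "med p z y = y"
              using y med_eq_left[OF p zX] med_commute[OF p zX] by (auto simp: B_def interval_iff)
            ultimately show "y \<in> med p z ` D'" by force
          qed
        qed
        have "b = med p z j'"
          using is_join_unique[OF p b] is_join_image_med[OF p zX D'(2) j'] img by simp
        then have "d p j = d p j' + d p z - d p b"
          using val med_commute[OF p zX is_joinD(1)[OF j']] by simp
        also have "\<dots> = sum g D' + g z"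
          using fD[OF D'(1) _ j'] down' gf[OF D'(1)] by (simp add: g_def)
        also have "\<dots> = sum g D"
          using sum.remove[OF _ zD, of g] D'(2) by (simp add: D'_def)
        finally show ?thesis .
      qed
    qed
  qed
qed

text \<open>For fixed \<open>p\<close>, \<open>med p\<close> is associative, commutative and
  idempotent, so a new point \<open>s\<close> adds only itself and its meets with old
  points.\<close>

lemma finite_med_closed:
  assumes "p \<in> X" "finite S" "S \<subseteq> X"
  obtains A where "finite A" "S \<subseteq> A" "A \<subseteq> X" "\<And>x y. \<lbrakk>x \<in> A; y \<in> A\<rbrakk> \<Longrightarrow> med p x y \<in> A"
  using assms(2,3)
proof (induction S arbitrary: thesis rule: finite_induct)
  case empty
  then show ?case by auto
next
  case (insert s S)
  then obtain A where A: "finite A" "S \<subseteq> A" "A \<subseteq> X" and cl: "\<And>x y. \<lbrakk>x \<in> A; y \<in> A\<rbrakk> \<Longrightarrow> med p x y \<in> A"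
    by auto
  have s: "s \<in> X" using insert.prems by simp
  have mX: "med p x y \<in> X" if "x \<in> X" "y \<in> X" for x y using med_in_intervals(4) assms(1) that by auto
  note [simp] = med_idem[OF assms(1)]
  note comm = med_commute[OF assms(1)] and assoc = med_assoc[OF assms(1)]
  have absorb: "med p x (med p x y) = med p x y" if "x \<in> X" "y \<in> X" for x y
    using assoc[OF that(1,1,2)] that by simp
  have left: "med p x (med p y z) = med p y (med p x z)" if "x \<in> X" "y \<in> X" "z \<in> X" for x y z
    using assoc that comm by metis
  let ?A = "insert s A \<union> med p s ` A"
  show ?case
  proof (rule insert.prems(1))
    show "finite ?A" "insert s S \<subseteq> ?A" "?A \<subseteq> X" using A s mX by auto
    fix x y assume xy: "x \<in> ?A" "y \<in> ?A"
    have sub: "a \<in> X" if "a \<in> A" for a using that A by auto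
    have c1: "med p s y \<in> ?A" if "y \<in> ?A" for y
      using that s sub absorb by auto
    have c2: "med p x y \<in> ?A" if "x \<in> A" "y \<in> ?A" for x y
      using that s sub left[of x s] comm[of x s] cl by auto
    have yX: "y \<in> X" using xy A s mX by auto
    from xy(1) consider "x = s" | "x \<in> A" | a where "a \<in> A" "x = med p s a" by auto
    then show "med p x y \<in> ?A"
    proof cases
      case 3
      then show ?thesis using assoc[OF s sub yX] c1[OF c2[OF _ xy(2)]] by simp
    qed (use c1 c2 xy in auto)
  qed
qed

text \<open>Each entry is twice the height of a meet, hence twice the mass of the points of
  \<open>A\<close> below both arguments; the double sum becomes a sum of squares weighted by
  \<open>f\<close>.\<close>

lemma gromov_product_positive:
  fixes c :: "'i \<Rightarrow> real"
  assumes p: "p \<in> X" and fin: "finite J" and x: "\<And>i. i \<in> J \<Longrightarrow> x i \<in> X"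
  shows "0 \<le> (\<Sum>i\<in>J. \<Sum>j\<in>J. c i * c j * (d p (x i) + d p (x j) - d (x i) (x j)))"
proof -
  obtain A where A: "finite A" "x ` J \<subseteq> A" "A \<subseteq> X" and cl: "\<And>u v. \<lbrakk>u \<in> A; v \<in> A\<rbrakk> \<Longrightarrow> med p u v \<in> A"
    using finite_med_closed[OF p, of "x ` J"] fin x by auto
  obtain f where f: "is_join_density p A f" using is_join_density_exists[OF p A(1,3) cl] by auto
  define e where "e z u = (if z \<in> I p u then 1 else 0 :: real)" for z u
  have *: "d p (x i) + d p (x j) - d (x i) (x j) = 2 * (\<Sum>z\<in>A. f z * e z (x i) * e z (x j))"
    if "i \<in> J" "j \<in> J" for i j
  proof -
    let ?m = "med p (x i) (x j)"
    have ij: "x i \<in> X" "x j \<in> X" using x that by auto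
    note m = med_in_intervals[OF p ij]
    have mA: "?m \<in> A" using cl A that by auto
    let ?D = "{z \<in> A. z \<in> I p ?m}"
    have "is_join p ?D ?m" using m mA p by (auto simp: is_join_def endpoints_in_interval)
    then have "d p ?m = sum f ?D" by (intro is_join_densityD(2)[OF f]) (auto intro: geodesic_chain(1)[OF p m(4)])
    also have "\<dots> = (\<Sum>z\<in>A. f z * e z (x i) * e z (x j))"
    proof (rule sum.mono_neutral_cong_left[OF A(1)])
      show "\<forall>z\<in>A - ?D. f z * e z (x i) * e z (x j) = 0"
        using med_greatest[OF p ij] by (auto simp: e_def)
      show "f z = f z * e z (x i) * e z (x j)" if "z \<in> ?D" for z
        using that geodesic_chain(1)[OF p ij(1) m(1)] geodesic_chain(1)[OF p ij(2) m(3)]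
        by (auto simp: e_def)
    qed auto
    finally show ?thesis using dist_med[OF p ij] by simp
  qed
  have "(\<Sum>i\<in>J. \<Sum>j\<in>J. c i * c j * (d p (x i) + d p (x j) - d (x i) (x j)))
      = (\<Sum>i\<in>J. \<Sum>j\<in>J. \<Sum>z\<in>A. 2 * f z * (c i * e z (x i)) * (c j * e z (x j)))"
    by (intro sum.cong refl) (simp add: * sum_distrib_left mult_ac)
  also have "\<dots> = (\<Sum>i\<in>J. \<Sum>z\<in>A. \<Sum>j\<in>J. 2 * f z * (c i * e z (x i)) * (c j * e z (x j)))"
    by (intro sum.cong refl sum.swap)
  also have "\<dots> = (\<Sum>z\<in>A. \<Sum>i\<in>J. \<Sum>j\<in>J. 2 * f z * (c i * e z (x i)) * (c j * e z (x j)))"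
    by (rule sum.swap)
  also have "\<dots> = (\<Sum>z\<in>A. 2 * f z * (\<Sum>i\<in>J. c i * e z (x i))\<^sup>2)"
    unfolding power2_eq_square sum_product by (simp add: sum_distrib_left mult.assoc)
  also have "\<dots> \<ge> 0" using is_join_densityD(1)[OF f] by (intro sum_nonneg) auto
  finally show ?thesis .
qed

text \<open>As the coefficients sum to zero, the \<open>d p\<close> terms of the Gromov product
  cancel. The points form a family, so that an orbit map with repetitions is covered.\<close>

lemma dist_negative_definite:
  fixes c :: "'i \<Rightarrow> real"
  assumes "finite J" "\<And>i. i \<in> J \<Longrightarrow> x i \<in> X" "sum c J = 0"
  shows "(\<Sum>i\<in>J. \<Sum>j\<in>J. c i * c j * d (x i) (x j)) \<le> 0"
proof (cases "J = {}")
  case False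
  then obtain p where p: "p \<in> X" using assms by auto
  have 1: "(\<Sum>i\<in>J. \<Sum>j\<in>J. c i * c j * d p (x i)) = 0"
  proof -
    have "(\<Sum>i\<in>J. \<Sum>j\<in>J. c i * c j * d p (x i)) = (\<Sum>i\<in>J. c i * d p (x i) * sum c J)"
      unfolding sum_distrib_left by (simp add: mult_ac)
    then show ?thesis by (simp add: assms(3))
  qed
  have 2: "(\<Sum>i\<in>J. \<Sum>j\<in>J. c i * c j * d p (x j)) = 0"
    by (simp add: assms(3) mult.assoc flip: sum_distrib_left sum_distrib_right)
  show ?thesis
    using gromov_product_positive[OF p assms(1), where x = x and c = c] assms(2) 1 2
    by (simp add: algebra_simps sum.distrib sum_subtractf)
qed simp

end

section \<open>Hilbert spaces from the parallelogram law\<close>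

text \<open>The deviation from \<open>a * f 1\<close> vanishes at integers, so it is determined by
  fractional parts and bounded by \<open>K\<close>; additivity multiplies it by \<open>n\<close>, so
  it must be zero.\<close>

lemma additive_bounded_imp_linear:
  fixes f :: "real \<Rightarrow> real"
  assumes add: "\<And>a b. f (a + b) = f a + f b" and bound: "\<And>a. \<bar>a\<bar> \<le> 1 \<Longrightarrow> \<bar>f a\<bar> \<le> M"
  shows "f a = a * f 1"
proof -
  interpret additive f by unfold_locales (rule add)
  have nat: "f (real n * x) = real n * f x" for n x
    by (induction n) (simp_all add: zero add algebra_simps)
  have int: "f (of_int k) = of_int k * f 1" for k
  proof (cases k)
    case (nonneg n) then show ?thesis using nat[of n 1] by simp
  next
    case (neg n) then show ?thesis using nat[of "Suc n" 1] minus[of "real (Suc n)"]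
      by (simp del: of_nat_Suc)
  qed
  define K where "K = M + \<bar>f 1\<bar>"
  have "real n * \<bar>f a - a * f 1\<bar> \<le> K" for n
  proof -
    let ?x = "real n * a"
    have "f ?x = f (of_int \<lfloor>?x\<rfloor>) + f (frac ?x)" by (simp add: frac_def flip: add)
    then have "real n * (f a - a * f 1) = f (frac ?x) - frac ?x * f 1"
      using nat[of n a] int[of "\<lfloor>?x\<rfloor>"] by (simp add: frac_def algebra_simps)
    moreover have "\<bar>f (frac ?x)\<bar> \<le> M" using frac_lt_1[of ?x] by (intro bound) simp
    moreover have "\<bar>frac ?x * f 1\<bar> \<le> \<bar>f 1\<bar>"
      using frac_lt_1[of ?x] by (simp add: abs_mult mult_left_le_one_le)
    moreover have "real n * \<bar>f a - a * f 1\<bar> = \<bar>real n * (f a - a * f 1)\<bar>" by (simp add: abs_mult)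
    ultimately show ?thesis by (simp add: K_def)
  qed
  then have "\<bar>f a - a * f 1\<bar> \<le> 0" by (meson not_le reals_Archimedean3)
  then show ?thesis by simp
qed

text \<open>A Hilbert space known only through its squared norm, as in the Jordan-von Neumann
  theorem. This suits a norm defined by a supremum, where no bilinear form is visible.\<close>

locale complete_quadratic_space = vector_space scale
  for scale :: "real \<Rightarrow> 'v \<Rightarrow> 'v::ab_group_add" (infixr \<open>\<cdot>\<close> 75) +
  fixes H :: "'v set" and q :: "'v \<Rightarrow> real"
  assumes subspace_H: "subspace H"
    and q_nonneg: "x \<in> H \<Longrightarrow> 0 \<le> q x"
    and q_scale: "x \<in> H \<Longrightarrow> q (a \<cdot> x) = a\<^sup>2 * q x"
    and q_eq_zero: "\<lbrakk>x \<in> H; q x = 0\<rbrakk> \<Longrightarrow> x = 0"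
    and q_parallelogram: "\<lbrakk>x \<in> H; y \<in> H\<rbrakk> \<Longrightarrow> q (x + y) + q (x - y) = 2 * q x + 2 * q y"
    and q_complete: "\<lbrakk>\<And>n. u n \<in> H; \<And>e. 0 < e \<Longrightarrow> \<exists>N. \<forall>m\<ge>N. \<forall>n\<ge>N. q (u m - u n) < e\<rbrakk>
      \<Longrightarrow> \<exists>x\<in>H. (\<lambda>n. q (u n - x)) \<longlonglongrightarrow> 0"
begin

lemmas H_closed = subspace_add[OF subspace_H] subspace_diff[OF subspace_H]
  subspace_scale[OF subspace_H] subspace_0[OF subspace_H] subspace_neg[OF subspace_H]

lemma q_minus: "x \<in> H \<Longrightarrow> q (- x) = q x"
  using q_scale[of x "-1"] by simp

lemma q_diff_commute: "\<lbrakk>x \<in> H; y \<in> H\<rbrakk> \<Longrightarrow> q (x - y) = q (y - x)"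
  using q_minus[of "x - y"] H_closed by simp

lemma q_zero: "q 0 = 0"
  using q_scale[of 0 0] H_closed by simp

definition form where "form x y = (q (x + y) - q (x - y)) / 4"

lemma form_commute: "\<lbrakk>x \<in> H; y \<in> H\<rbrakk> \<Longrightarrow> form x y = form y x"
  by (simp add: form_def add.commute q_diff_commute)

lemma form_self: "x \<in> H \<Longrightarrow> form x x = q x"
  using q_parallelogram[of x x] by (simp add: form_def q_zero)

lemma form_zero_left: "y \<in> H \<Longrightarrow> form 0 y = 0"
  by (simp add: form_def q_minus)

text \<open>Two parallelograms, with sides \<open>x + z\<close>, \<open>y\<close> and
  \<open>x - z\<close>, \<open>y\<close>, are subtracted.\<close>

lemma form_add_diff:
  assumes "x \<in> H" "y \<in> H" "z \<in> H"
  shows "form (x + y) z + form (x - y) z = 2 * form x z"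
proof -
  have "q (x + y + z) + q (x - y + z) = 2 * q (x + z) + 2 * q y"
    using q_parallelogram[of "x + z" y] assms by (simp add: H_closed algebra_simps)
  moreover have "q (x + y - z) + q (x - y - z) = 2 * q (x - z) + 2 * q y"
    using q_parallelogram[of "x - z" y] assms by (simp add: H_closed algebra_simps)
  ultimately show ?thesis unfolding form_def by argo
qed

lemma form_add_left:
  assumes "x \<in> H" "y \<in> H" "z \<in> H"
  shows "form (x + y) z = form x z + form y z"
proof -
  let ?u = "(1/2) \<cdot> (x + y)" and ?v = "(1/2) \<cdot> (x - y)"
  have uv: "?u \<in> H" "?v \<in> H" using assms H_closed by auto
  have half: "(1/2) \<cdot> w + (1/2) \<cdot> w = w" for w
    by (simp flip: scale_left_distrib)
  have "?u + ?v = (1/2) \<cdot> x + (1/2) \<cdot> x" "?u - ?v = (1/2) \<cdot> y + (1/2) \<cdot> y"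
    by (simp_all add: algebra_simps)
  then have eq: "?u + ?v = x" "?u - ?v = y" by (simp_all add: half)
  have "form (?u + ?u) z = 2 * form ?u z"
    using form_add_diff[OF uv(1,1) assms(3)] form_zero_left assms by simp
  then show ?thesis using form_add_diff[OF uv assms(3)] half[of "x + y"] eq by simp
qed

text \<open>Additivity alone reaches only rational scalars. The parallelogram law with
  \<open>q\<close> nonnegative bounds the form for scalars in [-1, 1], which replaces
  continuity.\<close>

lemma form_scale_left:
  assumes "x \<in> H" "y \<in> H"
  shows "form (a \<cdot> x) y = a * form x y"
proof -
  have bound: "\<bar>form (b \<cdot> x) y\<bar> \<le> (q x + q y) / 2" if "\<bar>b\<bar> \<le> 1" for b
  proof -
    have b: "b \<cdot> x \<in> H" using assms H_closed by auto
    have "b\<^sup>2 * q x \<le> q x"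
      using that q_nonneg[OF assms(1)] by (intro mult_left_le_one_le) (auto simp: abs_square_le_1)
    then have "q (b \<cdot> x + y) + q (b \<cdot> x - y) \<le> 2 * q x + 2 * q y"
      using q_parallelogram[OF b assms(2)] q_scale[OF assms(1), of b] by simp
    moreover have "0 \<le> q (b \<cdot> x + y)" "0 \<le> q (b \<cdot> x - y)"
      using b assms H_closed q_nonneg by auto
    ultimately show ?thesis unfolding form_def by argo
  qed
  have add: "form ((b + c) \<cdot> x) y = form (b \<cdot> x) y + form (c \<cdot> x) y" for b c
    using form_add_left assms H_closed by (simp add: scale_left_distrib)
  have "form (a \<cdot> x) y = a * form (1 \<cdot> x) y"
    by (rule additive_bounded_imp_linear[where f = "\<lambda>b. form (b \<cdot> x) y", OF add bound])
  then show ?thesis by simp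
qed

theorem hilbert_space_model:
  assumes "H \<lesssim> (UNIV :: 'h set)"
  obtains V :: "(real, 'h) module" and ip \<iota> where "real_hilbert_space V ip" "bij_betw \<iota> H (carrier V)"
    "\<And>x y. \<lbrakk>x \<in> H; y \<in> H\<rbrakk> \<Longrightarrow> ip_dist V ip (\<iota> x) (\<iota> y) = sqrt (q (x - y))"
proof -
  obtain \<iota> :: "'v \<Rightarrow> 'h" where inj: "inj_on \<iota> H" using assms by (auto simp: lepoll_def)
  define j where "j = inv_into H \<iota>"
  have j [simp]: "j (\<iota> x) = x" if "x \<in> H" for x using inj that by (simp add: j_def)
  define V :: "(real, 'h) module" where
    "V = \<lparr>carrier = \<iota> ` H, mult = (\<lambda>x y. x), one = \<iota> 0, zero = \<iota> 0,
      add = (\<lambda>x y. \<iota> (j x + j y)), smult = (\<lambda>a x. \<iota> (a \<cdot> j x))\<rparr>"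
  define ip where "ip x y = form (j x) (j y)" for x y
  have V [simp]: "carrier V = \<iota> ` H" "\<zero>\<^bsub>V\<^esub> = \<iota> 0"
      "x \<oplus>\<^bsub>V\<^esub> y = \<iota> (j x + j y)" "a \<odot>\<^bsub>V\<^esub> x = \<iota> (a \<cdot> j x)" for x y a
    by (simp_all add: V_def)
  note [simp] = H_closed
  have "cring real_ring"
  proof (intro cringI abelian_groupI comm_monoidI)
    show "\<exists>y\<in>carrier real_ring. y \<oplus>\<^bsub>real_ring\<^esub> x = \<zero>\<^bsub>real_ring\<^esub>" for x
      by (rule bexI[of _ "- x"]) (simp_all add: real_ring_def)
  qed (simp_all add: real_ring_def algebra_simps)
  moreover have "abelian_group V"
  proof (rule abelian_groupI)
    fix x assume "x \<in> carrier V"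
    then obtain a where "a \<in> H" "x = \<iota> a" by auto
    then show "\<exists>y\<in>carrier V. y \<oplus>\<^bsub>V\<^esub> x = \<zero>\<^bsub>V\<^esub>" by (intro bexI[of _ "\<iota> (- a)"]) auto
  qed (auto simp: algebra_simps)
  ultimately have "module real_ring V"
    by (intro moduleI) (auto simp: real_ring_def algebra_simps)
  then have ips: "real_inner_product_space V ip"
  proof (intro real_inner_product_space.intro real_inner_product_space_axioms.intro)
    show "x = \<zero>\<^bsub>V\<^esub>" if "x \<in> carrier V" "ip x x = 0" for x
    proof -
      from that(1) obtain a where a: "a \<in> H" "x = \<iota> a" by auto
      then show ?thesis using that(2) q_eq_zero[of a] by (simp add: ip_def form_self)
    qed
  qed (auto simp: ip_def form_add_left form_scale_left form_self q_nonneg intro: form_commute)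
  interpret real_inner_product_space V ip by (rule ips)
  have minus: "\<iota> x \<ominus>\<^bsub>V\<^esub> \<iota> y = \<iota> (x - y)" if "x \<in> H" "y \<in> H" for x y
  proof -
    have "\<ominus>\<^bsub>V\<^esub> \<iota> y = \<iota> (- y)" using that by (intro M.minus_equality) auto
    then show ?thesis using that by (simp add: M.minus_eq)
  qed
  have dist: "ip_dist V ip (\<iota> x) (\<iota> y) = sqrt (q (x - y))" if "x \<in> H" "y \<in> H" for x y
    using that by (simp add: ip_dist_def minus ip_def form_self)
  interpret ms: Metric_space "carrier V" "ip_dist V ip" by (rule ip_Metric_space)
  have "ms.mcomplete"
    unfolding ms.mcomplete_def
  proof (intro allI impI)
    fix \<sigma> assume \<sigma>: "ms.MCauchy \<sigma>"
    define u where "u n = j (\<sigma> n)" for n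
    have u: "u n \<in> H" "\<sigma> n = \<iota> (u n)" for n
    proof -
      have "\<sigma> n \<in> \<iota> ` H" using \<sigma> unfolding ms.MCauchy_def by auto
      then obtain a where "a \<in> H" "\<sigma> n = \<iota> a" by auto
      then show "u n \<in> H" "\<sigma> n = \<iota> (u n)" by (simp_all add: u_def)
    qed
    have "\<exists>N. \<forall>m\<ge>N. \<forall>n\<ge>N. q (u m - u n) < e" if "0 < e" for e
    proof -
      have "0 < sqrt e" using that by simp
      then obtain N where "\<And>m n. N \<le> m \<Longrightarrow> N \<le> n \<Longrightarrow> ip_dist V ip (\<sigma> m) (\<sigma> n) < sqrt e"
        using \<sigma> unfolding ms.MCauchy_def by meson
      then show ?thesis using u by (metis dist real_sqrt_less_iff)
    qed
    then obtain x where x: "x \<in> H" "(\<lambda>n. q (u n - x)) \<longlonglongrightarrow> 0" using q_complete u by blast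
    then have "(\<lambda>n. ip_dist V ip (\<sigma> n) (\<iota> x)) \<longlonglongrightarrow> 0"
      using tendsto_real_sqrt[OF x(2)] u dist by simp
    then have "limitin ms.mtopology \<sigma> (\<iota> x) sequentially"
      using x(1) u unfolding ms.limitin_metric_dist_null by auto
    then show "\<exists>x. limitin ms.mtopology \<sigma> x sequentially" ..
  qed
  then have "real_hilbert_space V ip"
    by (intro real_hilbert_space.intro ips real_hilbert_space_axioms.intro)
  then show thesis using dist inj by (intro that[of V ip \<iota>]) (auto intro: inj_on_imp_bij_betw)
qed

end

section \<open>Recognising group actions, and counting functions\<close>

lemma group_actionI:
  fixes G (structure)
  assumes "group G"
    and ext: "\<And>g. g \<in> carrier G \<Longrightarrow> \<phi> g \<in> extensional E"
    and cl: "\<And>g x. \<lbrakk>g \<in> carrier G; x \<in> E\<rbrakk> \<Longrightarrow> \<phi> g x \<in> E"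
    and one: "\<And>x. x \<in> E \<Longrightarrow> \<phi> \<one> x = x"
    and mult: "\<And>g h x. \<lbrakk>g \<in> carrier G; h \<in> carrier G; x \<in> E\<rbrakk> \<Longrightarrow> \<phi> (g \<otimes> h) x = \<phi> g (\<phi> h x)"
  shows "group_action G E \<phi>"
proof -
  interpret group G by fact
  have bij: "\<phi> g \<in> Bij E" if g: "g \<in> carrier G" for g
  proof -
    have "\<phi> (inv g) (\<phi> g x) = x" "\<phi> g (\<phi> (inv g) x) = x" if "x \<in> E" for x
      using that g one mult[of g "inv g" x] mult[of "inv g" g x] by simp_all
    then have "bij_betw (\<phi> g) E E"
      using g cl by (intro bij_betw_byWitness[where f' = "\<phi> (inv g)"]) auto
    then show ?thesis using ext g by (simp add: Bij_def)
  qed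
  have "\<phi> \<in> hom G (BijGroup E)"
  proof (rule homI)
    show "\<phi> g \<in> carrier (BijGroup E)" if "g \<in> carrier G" for g using bij that by (simp add: BijGroup_def)
    fix g h assume gh: "g \<in> carrier G" "h \<in> carrier G"
    have "\<phi> (g \<otimes> h) = compose E (\<phi> g) (\<phi> h)"
      using ext[OF m_closed[OF gh]] mult[OF gh]
      by (intro extensionalityI[of _ E]) (auto simp: compose_def)
    then show "\<phi> (g \<otimes> h) = \<phi> g \<otimes>\<^bsub>BijGroup E\<^esub> \<phi> h" using bij gh by (simp add: BijGroup_def)
  qed
  then show ?thesis
    by (intro group_action.intro group_hom.intro group_hom_axioms.intro group_BijGroup assms(1))
qed

text \<open>With reals coded as sets of naturals, a function on a countable set becomes a set of
  pairs of naturals, hence one real; the slice over the index of \<open>x\<close> recovers the value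
  at \<open>x\<close>.\<close>

lemma countable_support_functions_lepoll:
  assumes "countable A"
  shows "{F :: 'a \<Rightarrow> real. \<forall>x. x \<notin> A \<longrightarrow> F x = 0} \<lesssim> (UNIV :: real set)"
proof -
  obtain \<rho> :: "real \<Rightarrow> nat set" where \<rho>: "inj \<rho>"
    using nat_sets_eqpoll_reals by (metis eqpoll_sym eqpoll_imp_lepoll lepoll_def)
  obtain \<theta> :: "nat set \<Rightarrow> real" where \<theta>: "inj \<theta>"
    using nat_sets_eqpoll_reals by (metis eqpoll_imp_lepoll lepoll_def)
  define code where
    "code F = \<theta> (prod_encode ` (SIGMA x:to_nat_on A ` A. \<rho> (F (from_nat_into A x))))" for F :: "'a \<Rightarrow> real"
  have "inj_on code {F. \<forall>x. x \<notin> A \<longrightarrow> F x = 0}"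
  proof (rule inj_onI, rule ext)
    fix F E :: "'a \<Rightarrow> real" and x
    assume F: "F \<in> {F. \<forall>x. x \<notin> A \<longrightarrow> F x = 0}" and E: "E \<in> {F. \<forall>x. x \<notin> A \<longrightarrow> F x = 0}"
      and eq: "code F = code E"
    have eq': "(SIGMA x:to_nat_on A ` A. \<rho> (F (from_nat_into A x)))
        = (SIGMA x:to_nat_on A ` A. \<rho> (E (from_nat_into A x)))"
      using eq \<theta> by (simp add: code_def inj_eq inj_image_eq_iff[OF inj_prod_encode])
    show "F x = E x"
    proof (cases "x \<in> A")
      case True
      have "\<rho> (F x) = \<rho> (E x)"
        using arg_cong[OF eq', of "\<lambda>S. S `` {to_nat_on A x}"] True assms by (auto simp: Image_def)
      then show ?thesis using \<rho> by (simp add: inj_eq)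
    qed (use F E in auto)
  qed
  then show ?thesis by (auto simp: lepoll_def)
qed

section \<open>The affine action defined by an invariant kernel\<close>

definition scale_fun :: "real \<Rightarrow> ('i \<Rightarrow> real) \<Rightarrow> 'i \<Rightarrow> real" where
  "scale_fun a F i = a * F i"

interpretation function_space: vector_space scale_fun
  by unfold_locales (auto simp: scale_fun_def algebra_simps)

text \<open>\<open>D g h\<close> stands for the distance between the translates of a base point by
  \<open>g\<close> and \<open>h\<close>; it may vanish for distinct elements when the base point has
  a stabiliser.\<close>

locale negative_definite_kernel = group G for G :: "('g, 'b) monoid_scheme" (structure) +
  fixes D :: "'g \<Rightarrow> 'g \<Rightarrow> real"
  assumes D_sym: "\<lbrakk>g \<in> carrier G; h \<in> carrier G\<rbrakk> \<Longrightarrow> D g h = D h g"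
    and D_zero: "g \<in> carrier G \<Longrightarrow> D g g = 0"
    and D_invariant: "\<lbrakk>k \<in> carrier G; g \<in> carrier G; h \<in> carrier G\<rbrakk> \<Longrightarrow> D (k \<otimes> g) (k \<otimes> h) = D g h"
    and D_negative: "\<And>S c. \<lbrakk>finite S; S \<subseteq> carrier G; sum c S = 0\<rbrakk>
      \<Longrightarrow> (\<Sum>g\<in>S. \<Sum>h\<in>S. c g * c h * D g h) \<le> 0"
begin

section \<open>Functions of finite support and sum zero\<close>

definition supp :: "('g \<Rightarrow> real) \<Rightarrow> 'g set" where "supp c = {g. c g \<noteq> 0}"

text \<open>Sum zero makes the form \<open>B\<close> nonnegative and \<open>pair\<close> blind to
  constants, so that functions can be normalised at the identity.\<close>

definition W where "W = {c. finite (supp c) \<and> supp c \<subseteq> carrier G \<and> sum c (supp c) = 0}"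

definition pair where "pair c F = (\<Sum>g\<in>supp c. c g * F g)"

lemma sum_supp: "\<lbrakk>finite S; supp c \<subseteq> S\<rbrakk> \<Longrightarrow> sum c (supp c) = sum c S"
  by (intro sum.mono_neutral_left) (auto simp: supp_def)

lemma pair_eq: "\<lbrakk>finite S; supp c \<subseteq> S\<rbrakk> \<Longrightarrow> pair c F = (\<Sum>g\<in>S. c g * F g)"
  unfolding pair_def by (intro sum.mono_neutral_left) (auto simp: supp_def)

lemma WD: "c \<in> W \<Longrightarrow> finite (supp c)" "c \<in> W \<Longrightarrow> supp c \<subseteq> carrier G"
  by (auto simp: W_def)

lemma WI: "\<lbrakk>finite S; supp c \<subseteq> S; S \<subseteq> carrier G; sum c S = 0\<rbrakk> \<Longrightarrow> c \<in> W"
  using sum_supp[of S c] by (auto simp: W_def intro: finite_subset)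

lemma pair_const: "c \<in> W \<Longrightarrow> pair c (\<lambda>g. t) = 0"
  by (simp add: W_def pair_def flip: sum_distrib_right)

lemma pair_cong: "\<lbrakk>c \<in> W; \<And>g. g \<in> carrier G \<Longrightarrow> F g = E g\<rbrakk> \<Longrightarrow> pair c F = pair c E"
  unfolding pair_def by (intro sum.cong refl) (use WD(2)[of c] in auto)

lemma supp_add: "supp (c + e) \<subseteq> supp c \<union> supp e"
  and supp_diff: "supp (c - e) \<subseteq> supp c \<union> supp e"
  and supp_scal: "supp (scale_fun a c) \<subseteq> supp c"
  by (auto simp: supp_def scale_fun_def)

lemma subspace_W: "function_space.subspace W"
proof (rule function_space.subspaceI)
  show "0 \<in> W" by (simp add: W_def supp_def)
next
  fix c e assume c: "c \<in> W" and e: "e \<in> W"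
  let ?S = "supp c \<union> supp e"
  have fin: "finite ?S" using c e WD by auto
  show "c + e \<in> W"
  proof (rule WI[OF fin supp_add])
    show "?S \<subseteq> carrier G" using c e WD by auto
    show "sum (c + e) ?S = 0"
      using sum_supp[OF fin, of c] sum_supp[OF fin, of e] c e by (simp add: W_def sum.distrib)
  qed
next
  fix a c assume c: "c \<in> W"
  show "scale_fun a c \<in> W"
    by (rule WI[OF WD(1)[OF c] supp_scal WD(2)[OF c]]) (use c in \<open>simp add: W_def scale_fun_def flip: sum_distrib_left\<close>)
qed

lemmas W_closed = function_space.subspace_add[OF subspace_W] function_space.subspace_diff[OF subspace_W]
  function_space.subspace_scale[OF subspace_W] function_space.subspace_0[OF subspace_W]

lemma pair_add_left: "\<lbrakk>c \<in> W; e \<in> W\<rbrakk> \<Longrightarrow> pair (c + e) F = pair c F + pair e F"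
  and pair_diff_left: "\<lbrakk>c \<in> W; e \<in> W\<rbrakk> \<Longrightarrow> pair (c - e) F = pair c F - pair e F"
  using pair_eq[of "supp c \<union> supp e" "c + e"] pair_eq[of "supp c \<union> supp e" "c - e"]
    pair_eq[of "supp c \<union> supp e" c] pair_eq[of "supp c \<union> supp e" e] supp_add supp_diff WD(1)
  by (auto simp: sum.distrib sum_subtractf algebra_simps)

lemma pair_scal_left: "c \<in> W \<Longrightarrow> pair (scale_fun a c) F = a * pair c F"
  using pair_eq[OF WD(1) supp_scal, of c a F] by (simp add: pair_def scale_fun_def sum_distrib_left mult.assoc)

lemma pair_add_right: "pair c (F + E) = pair c F + pair c E"
  and pair_diff_right: "pair c (F - E) = pair c F - pair c E"
  by (auto simp: pair_def sum.distrib sum_subtractf algebra_simps)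

lemma pair_scal_right: "pair c (scale_fun a F) = a * pair c F"
  by (simp add: pair_def scale_fun_def sum_distrib_left algebra_simps)

lemma pair_zero: "pair c 0 = 0" "pair 0 F = 0"
  by (simp_all add: pair_def supp_def)

text \<open>The factor - 1 / 2 gives the difference of the point masses at \<open>g\<close> and
  \<open>h\<close> the squared length \<open>D g h\<close>.\<close>

definition B where "B c e = - pair c (\<lambda>g. pair e (D g)) / 2"

lemma B_eq: "B c e = - (\<Sum>g\<in>supp c. \<Sum>h\<in>supp e. c g * e h * D g h) / 2"
  by (simp add: B_def pair_def sum_distrib_left mult.assoc)

lemma B_commute: "\<lbrakk>c \<in> W; e \<in> W\<rbrakk> \<Longrightarrow> B c e = B e c"
  unfolding B_eq using WD(2)[of c] WD(2)[of e]
  by (subst sum.swap) (auto intro!: sum.cong simp: D_sym subset_iff mult_ac)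

lemma B_nonneg: "c \<in> W \<Longrightarrow> 0 \<le> B c c"
  using D_negative[of "supp c" c] by (simp add: B_eq W_def)

lemma B_left:
  "\<lbrakk>c \<in> W; e \<in> W; k \<in> W\<rbrakk> \<Longrightarrow> B (c + e) k = B c k + B e k"
  "\<lbrakk>c \<in> W; e \<in> W; k \<in> W\<rbrakk> \<Longrightarrow> B (c - e) k = B c k - B e k"
  "\<lbrakk>c \<in> W; k \<in> W\<rbrakk> \<Longrightarrow> B (scale_fun a c) k = a * B c k"
  by (simp_all add: B_def pair_add_left pair_diff_left pair_scal_left field_simps)

lemma B_right:
  "\<lbrakk>c \<in> W; e \<in> W; k \<in> W\<rbrakk> \<Longrightarrow> B k (c + e) = B k c + B k e"
  "\<lbrakk>c \<in> W; e \<in> W; k \<in> W\<rbrakk> \<Longrightarrow> B k (c - e) = B k c - B k e"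
  "\<lbrakk>c \<in> W; k \<in> W\<rbrakk> \<Longrightarrow> B k (scale_fun a c) = a * B k c"
  using B_left B_commute W_closed by metis+

text \<open>The functions on \<open>G\<close>, normalised at \<open>\<one>\<close>, that are bounded functionals for the form \<open>B\<close>. Their
  squared norm is written as a Legendre transform rather than as a quotient, since \<open>B\<close> may be
  degenerate and since the parallelogram law is then a substitution.\<close>

definition H where
  "H = {F. F \<one> = 0 \<and> (\<forall>g. g \<notin> carrier G \<longrightarrow> F g = 0) \<and>
     bdd_above ((\<lambda>c. 2 * pair c F - B c c) ` W)}"

definition q where "q F = (SUP c\<in>W. 2 * pair c F - B c c)"

section \<open>The dual squared norm and its completeness\<close>

lemma HI:
  assumes "F \<one> = 0" "\<And>g. g \<notin> carrier G \<Longrightarrow> F g = 0" "\<And>c. c \<in> W \<Longrightarrow> 2 * pair c F - B c c \<le> M"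
  shows "F \<in> H" "q F \<le> M"
proof -
  show "F \<in> H" using assms by (auto simp: H_def bdd_above_def)
  have "W \<noteq> {}" using W_closed by auto
  then show "q F \<le> M" unfolding q_def by (rule cSUP_least) (rule assms)
qed

lemma le_q: "\<lbrakk>F \<in> H; c \<in> W\<rbrakk> \<Longrightarrow> 2 * pair c F - B c c \<le> q F"
  unfolding q_def H_def by (intro cSUP_upper) auto

lemma H_normalized: "F \<in> H \<Longrightarrow> F \<one> = 0" "\<lbrakk>F \<in> H; g \<notin> carrier G\<rbrakk> \<Longrightarrow> F g = 0"
  by (auto simp: H_def)

lemma q_nonneg: "F \<in> H \<Longrightarrow> 0 \<le> q F"
  using le_q[of F 0] W_closed by (simp add: pair_zero B_def)

lemma zero_in_H: "0 \<in> H" and q_zero: "q 0 = 0"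
proof -
  have *: "0 \<in> H" "q 0 \<le> 0" using HI[of 0 0] B_nonneg by (auto simp: pair_zero)
  then show "0 \<in> H" by simp
  show "q 0 = 0" using * q_nonneg by fastforce
qed

lemma scal_le:
  assumes "F \<in> H"
  shows "scale_fun a F \<in> H" "q (scale_fun a F) \<le> a\<^sup>2 * q F"
proof -
  have *: "2 * pair c (scale_fun a F) - B c c \<le> a\<^sup>2 * q F" if c: "c \<in> W" for c
  proof (cases "a = 0")
    case True
    then show ?thesis using B_nonneg[OF c] by (simp add: pair_zero)
  next
    case False
    let ?c = "scale_fun (1 / a) c"
    have "2 * pair ?c F - B ?c ?c \<le> q F" using le_q assms W_closed c by auto
    then have "a\<^sup>2 * (2 * pair ?c F - B ?c ?c) \<le> a\<^sup>2 * q F" by (simp add: mult_left_mono)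
    also have "a\<^sup>2 * (2 * pair ?c F - B ?c ?c) = 2 * pair c (scale_fun a F) - B c c"
      using False c W_closed
      by (simp add: pair_scal_left pair_scal_right B_left B_right power2_eq_square field_simps)
    finally show ?thesis .
  qed
  show "scale_fun a F \<in> H" "q (scale_fun a F) \<le> a\<^sup>2 * q F"
    using HI[OF _ _ *] H_normalized[OF assms] by (auto simp: scale_fun_def)
qed

lemma q_scal:
  assumes "F \<in> H"
  shows "q (scale_fun a F) = a\<^sup>2 * q F"
proof (cases "a = 0")
  case True
  then have "scale_fun a F = 0" by simp
  then show ?thesis using True q_zero by simp
next
  case False
  then have "q F \<le> (1 / a)\<^sup>2 * q (scale_fun a F)"
    using False scal_le(2)[OF scal_le(1)[OF assms], of "1 / a" a] by simp
  then have "a\<^sup>2 * q F \<le> q (scale_fun a F)" using False by (simp add: power_divide field_simps)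
  then show ?thesis using scal_le(2)[OF assms, of a] by simp
qed

lemma parallelogram_le:
  assumes F: "F \<in> H" and E: "E \<in> H"
  shows "F + E \<in> H" "F - E \<in> H" "q (F + E) + q (F - E) \<le> 2 * q F + 2 * q E"
proof -
  have *: "(2 * pair c (F + E) - B c c) + (2 * pair e (F - E) - B e e) \<le> 2 * q F + 2 * q E"
    if "c \<in> W" "e \<in> W" for c e
  proof -
    \<comment> \<open>Half sum and half difference obey the parallelogram law for \<open>B\<close>,
      while the pairings recombine to \<open>c\<close> against \<open>F + E\<close> and
      \<open>e\<close> against \<open>F - E\<close>. The suprema over \<open>c\<close> and
      \<open>e\<close> can then be taken separately.\<close>
    let ?a = "scale_fun (1 / 2) (c + e)" and ?b = "scale_fun (1 / 2) (c - e)"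
    have "2 * pair ?a F - B ?a ?a \<le> q F" "2 * pair ?b E - B ?b ?b \<le> q E"
      using le_q W_closed F E that by auto
    then show ?thesis
      using that W_closed by (simp add: pair_scal_left pair_add_left pair_diff_left pair_add_right
          pair_diff_right B_left B_right algebra_simps)
  qed
  have z: "2 * pair 0 K - B 0 0 = 0" for K by (simp add: pair_zero B_def)
  have zW: "0 \<in> W" using W_closed by auto
  show P: "F + E \<in> H"
    by (rule HI(1)[of _ "2 * q F + 2 * q E"]) (use *[OF _ zW] z H_normalized[OF F] H_normalized[OF E] in auto)
  show M: "F - E \<in> H"
    by (rule HI(1)[of _ "2 * q F + 2 * q E"]) (use *[OF zW] z H_normalized[OF F] H_normalized[OF E] in auto)
  have "q (F + E) \<le> 2 * q F + 2 * q E - q (F - E)"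
  proof (rule HI(2))
    fix c assume c: "c \<in> W"
    have "q (F - E) \<le> 2 * q F + 2 * q E - (2 * pair c (F + E) - B c c)"
      by (rule HI(2)) (use H_normalized[OF M] *[OF c] in \<open>auto simp: le_diff_eq add.commute\<close>)
    then show "2 * pair c (F + E) - B c c \<le> 2 * q F + 2 * q E - q (F - E)" by simp
  qed (use H_normalized[OF P] in auto)
  then show "q (F + E) + q (F - E) \<le> 2 * q F + 2 * q E" by simp
qed

text \<open>The reverse inequality is the proved one for \<open>F + E\<close> and
  \<open>F - E\<close>, whose sum and difference are twice \<open>F\<close> and twice
  \<open>E\<close>.\<close>

lemma parallelogram:
  assumes F: "F \<in> H" and E: "E \<in> H"
  shows "q (F + E) + q (F - E) = 2 * q F + 2 * q E"
proof (rule antisym[OF parallelogram_le(3)[OF F E]])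
  have "(F + E) + (F - E) = scale_fun 2 F" "(F + E) - (F - E) = scale_fun 2 E"
    by (auto simp: scale_fun_def)
  then show "2 * q F + 2 * q E \<le> q (F + E) + q (F - E)"
    using parallelogram_le(3)[OF parallelogram_le(1,2)[OF F E]] q_scal[OF F, of 2] q_scal[OF E, of 2]
    by simp
qed

lemma subspace_H: "function_space.subspace H"
  by (rule function_space.subspaceI) (use zero_in_H parallelogram_le scal_le in auto)

text \<open>Cauchy-Schwarz, by testing with a multiple of \<open>c\<close>. The optimal factor would
  be \<open>pair c F / B c c\<close>; the added 1 keeps the denominator positive for null vectors of
  \<open>B\<close>.\<close>

lemma pair_square_le:
  assumes F: "F \<in> H" and c: "c \<in> W"
  shows "(pair c F)\<^sup>2 \<le> q F * (B c c + 1)"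
proof -
  let ?p = "pair c F" and ?b = "B c c"
  have b: "0 \<le> ?b" using B_nonneg c by simp
  let ?t = "?p / (?b + 1)"
  have "2 * pair (scale_fun ?t c) F - B (scale_fun ?t c) (scale_fun ?t c) \<le> q F"
    using le_q W_closed F c by auto
  then have "2 * ?t * ?p - ?t\<^sup>2 * ?b \<le> q F"
    using c W_closed by (simp add: pair_scal_left B_left B_right power2_eq_square)
  moreover have "?t\<^sup>2 * ?b \<le> ?t\<^sup>2 * (?b + 1)" by (simp add: mult_left_mono)
  moreover have "?t\<^sup>2 * (?b + 1) = ?t * ?p" using b by (simp add: power2_eq_square)
  ultimately have "?t * ?p \<le> q F" by linarith
  then show ?thesis using b by (simp add: power2_eq_square field_simps)
qed

text \<open>Paired with a function normalised at the identity it returns the value at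
  \<open>g\<close>; thus point evaluations are bounded on \<open>H\<close>.\<close>

definition ev where "ev g = (\<lambda>h. of_bool (h = g) - of_bool (h = \<one>) :: real)"

lemma supp_ev: "supp (ev g) \<subseteq> {g, \<one>}"
  by (auto simp: supp_def ev_def)

lemma ev_in_W: "g \<in> carrier G \<Longrightarrow> ev g \<in> W"
  by (rule WI[OF _ supp_ev]) (cases "g = \<one>"; auto simp: ev_def)+

lemma pair_ev: "pair (ev g) F = F g - F \<one>"
  using pair_eq[OF _ supp_ev, of g F] by (cases "g = \<one>") (auto simp: ev_def)

lemma q_eq_zero:
  assumes F: "F \<in> H" and "q F = 0"
  shows "F = 0"
proof
  fix g show "F g = 0 g"
    using pair_square_le[OF F ev_in_W, of g] H_normalized[OF F] assms(2) by (cases "g \<in> carrier G") (auto simp: pair_ev)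
qed

text \<open>Bounded evaluations give a pointwise limit, and it is a limit for \<open>q\<close>
  because \<open>q\<close> is a supremum of expressions in finitely many values.\<close>

lemma q_complete:
  assumes u: "\<And>n. u n \<in> H" and cauchy: "\<And>e. 0 < e \<Longrightarrow> \<exists>N. \<forall>m\<ge>N. \<forall>n\<ge>N. q (u m - u n) < e"
  shows "\<exists>F\<in>H. (\<lambda>n. q (u n - F)) \<longlonglongrightarrow> 0"
proof -
  have diff: "u m - u n \<in> H" for m n using u parallelogram_le by blast
  have "Cauchy (\<lambda>n. u n g)" for g
  proof (cases "g \<in> carrier G")
    case True
    define K where "K = B (ev g) (ev g) + 1"
    have K: "0 < K" using B_nonneg[OF ev_in_W[OF True]] by (simp add: K_def)
    show ?thesis
      unfolding Cauchy_def dist_real_def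
    proof (intro allI impI)
      fix e :: real assume e: "0 < e"
      then obtain N where N: "\<And>m n. \<lbrakk>N \<le> m; N \<le> n\<rbrakk> \<Longrightarrow> q (u m - u n) < e\<^sup>2 / K"
        using cauchy[of "e\<^sup>2 / K"] K by auto
      have "\<bar>u m g - u n g\<bar> < e" if "N \<le> m" "N \<le> n" for m n
      proof -
        have "(u m g - u n g)\<^sup>2 \<le> q (u m - u n) * K"
          using pair_square_le[OF diff ev_in_W[OF True]] H_normalized(1)[OF u]
          by (simp add: pair_ev K_def)
        also have "\<dots> < e\<^sup>2" using N[OF that] K by (simp add: field_simps)
        finally show ?thesis using e by (intro power2_less_imp_less[of _ e]) auto
      qed
      then show "\<exists>M. \<forall>m\<ge>M. \<forall>n\<ge>M. \<bar>u m g - u n g\<bar> < e" by blast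
    qed
  qed (use H_normalized(2)[OF u] in \<open>simp add: Cauchy_def\<close>)
  then have "\<exists>l. (\<lambda>n. u n g) \<longlonglongrightarrow> l" for g by (simp add: convergentD Cauchy_convergent_iff)
  then obtain F where F: "\<And>g. (\<lambda>n. u n g) \<longlonglongrightarrow> F g" by metis
  have "F g = 0" if "\<And>n. u n g = 0" for g
    using LIMSEQ_unique[OF F[of g], of 0] that by simp
  then have norm: "F \<one> = 0" "\<And>g. g \<notin> carrier G \<Longrightarrow> F g = 0"
    using H_normalized[OF u] by auto
  \<comment> \<open>Lower semicontinuity of \<open>q\<close>: the bound passes to the limit in
    \<open>m\<close> for each fixed \<open>c\<close>, and only then is the supremum taken.\<close>
  have close: "u n - F \<in> H \<and> q (u n - F) \<le> e"
    if "\<And>m. N \<le> m \<Longrightarrow> q (u n - u m) < e" for n N e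
  proof -
    have "2 * pair c (u n - F) - B c c \<le> e" if c: "c \<in> W" for c
    proof (rule LIMSEQ_le_const2)
      show "(\<lambda>m. 2 * pair c (u n - u m) - B c c) \<longlonglongrightarrow> 2 * pair c (u n - F) - B c c"
        unfolding pair_def fun_diff_def by (intro tendsto_intros F)
      show "\<exists>N. \<forall>m\<ge>N. 2 * pair c (u n - u m) - B c c \<le> e"
        using le_q[OF diff c] \<open>\<And>m. N \<le> m \<Longrightarrow> q (u n - u m) < e\<close> by (meson le_less_trans less_imp_le)
    qed
    then show ?thesis using HI[of "u n - F" e] norm H_normalized[OF u] by auto
  qed
  obtain N where "\<And>m. N \<le> m \<Longrightarrow> q (u N - u m) < 1" using cauchy[of 1] by auto
  then have "u N - F \<in> H" using close by blast
  then have FH: "F \<in> H" using parallelogram_le(2)[OF u[of N], of "u N - F"] by simp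
  moreover have "(\<lambda>n. q (u n - F)) \<longlonglongrightarrow> 0"
  proof (rule LIMSEQ_I)
    fix r :: real assume "0 < r"
    then obtain N where "\<And>m n. \<lbrakk>N \<le> m; N \<le> n\<rbrakk> \<Longrightarrow> q (u m - u n) < r / 2" using cauchy[of "r / 2"] by auto
    then have "q (u n - F) \<le> r / 2" if "N \<le> n" for n using close[of N n "r / 2"] that by blast
    moreover have "0 \<le> q (u n - F)" for n using q_nonneg parallelogram_le(2)[OF u FH] by blast
    ultimately show "\<exists>no. \<forall>n\<ge>no. norm (q (u n - F) - 0) < r"
      using \<open>0 < r\<close> by (intro exI[of _ N]) (auto intro: le_less_trans[of _ "r / 2"])
  qed
  ultimately show ?thesis by blast
qed

sublocale hilb: complete_quadratic_space scale_fun H q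
  by unfold_locales
    (use subspace_H q_nonneg q_scal q_eq_zero parallelogram q_complete in auto)

section \<open>The cocycle and the affine isometric action\<close>

definition cocycle where
  "cocycle s g = (if g \<in> carrier G then (D s \<one> + D g \<one> - D s g) / 2 else 0)"

text \<open>Left translation, corrected by a constant so that the value at the identity is again
  0.\<close>

definition lin :: "'g \<Rightarrow> ('g \<Rightarrow> real) \<Rightarrow> 'g \<Rightarrow> real" where
  "lin s F g = (if g \<in> carrier G then F (inv s \<otimes> g) - F (inv s) else 0)"

definition act where "act s F = cocycle s + lin s F"

text \<open>The cocycle is the Gromov product at the identity. Up to a term constant in
  \<open>g\<close>, which \<open>W\<close> does not see, it is the function that \<open>ev s\<close>
  defines through the kernel.\<close>

lemma pair_cocycle:
  assumes "s \<in> carrier G" "c \<in> W"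
  shows "pair c (cocycle s) = B c (ev s)"
proof -
  have "pair c (cocycle s) = pair c (\<lambda>g. (D g \<one> - D g s) / 2 + D s \<one> / 2)"
    using assms by (intro pair_cong) (simp_all add: cocycle_def D_sym field_simps)
  also have "\<dots> = pair c (scale_fun (- 1 / 2) (\<lambda>g. D g s - D g \<one>) + (\<lambda>g. D s \<one> / 2))"
    by (rule arg_cong[of _ _ "pair c"]) (auto simp: scale_fun_def field_simps)
  also have "\<dots> = - 1 / 2 * pair c (\<lambda>g. D g s - D g \<one>)"
    by (simp only: pair_add_right pair_scal_right pair_const[OF assms(2)])
  finally show ?thesis by (simp add: B_def pair_ev)
qed

lemma B_ev: "s \<in> carrier G \<Longrightarrow> B (ev s) (ev s) = D s \<one>"
  by (simp add: B_def pair_ev D_zero D_sym)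

text \<open>Completing the square: the tested expression is \<open>D s \<one>\<close> minus
  \<open>B\<close> at \<open>c - ev s\<close>, so its maximum is at \<open>c = ev s\<close>.\<close>

lemma cocycle_in_H: "s \<in> carrier G \<Longrightarrow> cocycle s \<in> H"
  and q_cocycle: "s \<in> carrier G \<Longrightarrow> q (cocycle s) = D s \<one>"
proof -
  assume s: "s \<in> carrier G"
  have *: "2 * pair c (cocycle s) - B c c \<le> D s \<one>" if c: "c \<in> W" for c
    using B_nonneg[of "c - ev s"] pair_cocycle[OF s c] B_ev[OF s] B_commute[OF c ev_in_W[OF s]]
      c ev_in_W[OF s] by (simp add: W_closed B_left B_right)
  show H: "cocycle s \<in> H"
    by (rule HI(1)[OF _ _ *]) (auto simp: cocycle_def D_zero s)
  have "q (cocycle s) \<le> D s \<one>"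
    by (rule HI(2)[OF _ _ *]) (auto simp: cocycle_def D_zero s)
  moreover have "D s \<one> \<le> q (cocycle s)"
    using le_q[OF H ev_in_W[OF s]] pair_cocycle[OF s ev_in_W[OF s]] B_ev[OF s] by simp
  ultimately show "q (cocycle s) = D s \<one>" by simp
qed

lemma lin_le:
  assumes s: "s \<in> carrier G" and F: "F \<in> H"
  shows "lin s F \<in> H" "q (lin s F) \<le> q F"
proof -
  have *: "2 * pair c (lin s F) - B c c \<le> q F" if c: "c \<in> W" for c
  proof -
    \<comment> \<open>The translate of \<open>c\<close> has the same \<open>B\<close> by invariance
      of \<open>D\<close>, and its pairing with \<open>F\<close> is that of \<open>c\<close> with
      \<open>lin s F\<close>, since \<open>c\<close> annihilates the constant.\<close>
    define e where "e h = (if h \<in> carrier G then c (s \<otimes> h) else 0)" for h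
    have bij: "bij_betw (\<lambda>g. inv s \<otimes> g) (supp c) (supp e)"
      by (rule bij_betw_byWitness[where f' = "\<lambda>h. s \<otimes> h"])
         (use s WD(2)[OF c] in \<open>auto simp: supp_def e_def subset_iff m_assoc[symmetric] split: if_splits\<close>)
    have ec: "e (inv s \<otimes> g) = c g" if "g \<in> supp c" for g
      using that s WD(2)[OF c] by (auto simp: e_def m_assoc[symmetric] subset_iff)
    have "e \<in> W"
    proof (rule WI[of "supp e"])
      show "finite (supp e)" using bij WD(1)[OF c] bij_betw_finite by blast
      show "supp e \<subseteq> carrier G" by (auto simp: supp_def e_def)
      have "sum e (supp e) = (\<Sum>g\<in>supp c. e (inv s \<otimes> g))" by (rule sum.reindex_bij_betw[OF bij, symmetric])
      then show "sum e (supp e) = 0" using c ec by (simp add: W_def)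
    qed simp
    have shift: "pair e K = pair c (\<lambda>g. K (inv s \<otimes> g))" for K
    proof -
      have "pair e K = (\<Sum>g\<in>supp c. e (inv s \<otimes> g) * K (inv s \<otimes> g))"
        unfolding pair_def by (rule sum.reindex_bij_betw[OF bij, symmetric])
      then show ?thesis using ec by (simp add: pair_def)
    qed
    have "B e e = B c c"
      unfolding B_def shift
      by (simp, intro pair_cong c) (use s c in \<open>auto intro!: pair_cong simp: D_invariant\<close>)
    moreover have "pair c (lin s F) = pair e F"
    proof -
      have "pair c (lin s F) = pair c ((\<lambda>g. F (inv s \<otimes> g)) - (\<lambda>g. F (inv s)))"
        by (intro pair_cong c) (simp add: lin_def)
      then show ?thesis by (simp only: pair_diff_right pair_const[OF c] shift)
    qed
    ultimately show ?thesis using le_q[OF F \<open>e \<in> W\<close>] by simp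
  qed
  show "lin s F \<in> H" "q (lin s F) \<le> q F"
    using HI[OF _ _ *] s by (auto simp: lin_def)
qed

lemma q_lin:
  assumes s: "s \<in> carrier G" and F: "F \<in> H"
  shows "q (lin s F) = q F"
proof -
  have "lin (inv s) (lin s F) = F"
    using s H_normalized[OF F] by (auto simp: lin_def fun_eq_iff m_assoc[symmetric])
  then have "q F \<le> q (lin s F)"
    using lin_le(2)[OF _ lin_le(1)[OF s F], of "inv s"] s by simp
  then show ?thesis using lin_le(2)[OF s F] by simp
qed

lemma act_in_H: "\<lbrakk>s \<in> carrier G; F \<in> H\<rbrakk> \<Longrightarrow> act s F \<in> H"
  using parallelogram_le(1)[OF cocycle_in_H lin_le(1)] by (simp add: act_def)

lemma q_act_diff:
  assumes "s \<in> carrier G" "F \<in> H" "E \<in> H"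
  shows "q (act s F - act s E) = q (F - E)"
proof -
  have "act s F - act s E = lin s (F - E)" by (auto simp: act_def lin_def)
  then show ?thesis using q_lin[OF assms(1) parallelogram_le(2)[OF assms(2,3)]] by simp
qed

lemma act_one: "F \<in> H \<Longrightarrow> act \<one> F = F"
  using H_normalized[of F] by (auto simp: act_def lin_def cocycle_def fun_eq_iff D_zero D_sym)

text \<open>At the origin this is the cocycle identity
  \<open>cocycle (s \<otimes> t) = cocycle s + lin s (cocycle t)\<close>; translating the arguments
  of \<open>D\<close> by \<open>s\<close> removes the inverses.\<close>

lemma act_mult:
  assumes s: "s \<in> carrier G" and t: "t \<in> carrier G" and F: "F \<in> H"
  shows "act (s \<otimes> t) F = act s (act t F)"
proof
  fix g
  show "act (s \<otimes> t) F g = act s (act t F) g"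
  proof (cases "g \<in> carrier G")
    case g: True
    have "D (inv s \<otimes> g) \<one> = D s g"
      using D_invariant[of s "inv s \<otimes> g" \<one>] D_sym[of s g] s g by (simp add: m_assoc[symmetric])
    moreover have "D t (inv s \<otimes> g) = D (s \<otimes> t) g"
      using D_invariant[of s t "inv s \<otimes> g"] s t g by (simp add: m_assoc[symmetric])
    moreover have "D (inv s) \<one> = D s \<one>"
      using D_invariant[of s "inv s" \<one>] D_sym[of s \<one>] s by simp
    moreover have "D t (inv s) = D (s \<otimes> t) \<one>"
      using D_invariant[of s t "inv s"] s t by simp
    ultimately show ?thesis
      using s t g by (simp add: act_def lin_def cocycle_def inv_mult_group m_assoc field_simps)
  qed (simp add: act_def lin_def cocycle_def)
qed

text \<open>The origin serves as \<open>v\<close>: it is moved to the cocycle, whose squared norm is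
  known. Countability bounds the size of \<open>H\<close>, so that it embeds into
  \<open>'h\<close>.\<close>

theorem hilbert_action:
  assumes "countable (carrier G)" "(UNIV :: real set) \<lesssim> (UNIV :: 'h set)"
  obtains V :: "(real, 'h) module" and ip \<phi> v where "real_hilbert_space V ip"
    "isometric_action G (carrier V) (ip_dist V ip) \<phi>" "v \<in> carrier V"
    "\<And>g. g \<in> carrier G \<Longrightarrow> ip_dist V ip v (\<phi> g v) = sqrt (D g \<one>)"
proof -
  have "H \<subseteq> {F. \<forall>g. g \<notin> carrier G \<longrightarrow> F g = 0}" by (auto simp: H_def)
  then have "H \<lesssim> (UNIV :: 'h set)"
    using countable_support_functions_lepoll[OF assms(1)] assms(2) subset_imp_lepoll lepoll_trans by meson
  then obtain V :: "(real, 'h) module" and ip \<iota> where V: "real_hilbert_space V ip"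
    and bij: "bij_betw \<iota> H (carrier V)"
    and dist: "\<And>F E. \<lbrakk>F \<in> H; E \<in> H\<rbrakk> \<Longrightarrow> ip_dist V ip (\<iota> F) (\<iota> E) = sqrt (q (F - E))"
    using hilb.hilbert_space_model by blast
  define j where "j = inv_into H \<iota>"
  have j: "j x \<in> H" "\<iota> (j x) = x" if "x \<in> carrier V" for x
    using bij that by (auto simp: j_def bij_betw_def inv_into_into f_inv_into_f)
  have ji: "j (\<iota> F) = F" "\<iota> F \<in> carrier V" if "F \<in> H" for F
    using bij that by (auto simp: j_def bij_betw_def)
  define \<phi> where "\<phi> g = (\<lambda>x\<in>carrier V. \<iota> (act g (j x)))" for g
  have \<phi>: "\<phi> g x \<in> carrier V" if "g \<in> carrier G" "x \<in> carrier V" for g x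
    using that j ji act_in_H by (simp add: \<phi>_def)
  have "group_action G (carrier V) \<phi>"
  proof (rule group_actionI[OF is_group])
    fix g h x assume "g \<in> carrier G" "h \<in> carrier G" "x \<in> carrier V"
    then show "\<phi> (g \<otimes> h) x = \<phi> g (\<phi> h x)"
      using \<phi> j(1) ji act_in_H by (simp add: \<phi>_def act_mult)
  qed (use \<phi> j in \<open>auto simp: \<phi>_def act_one\<close>)
  moreover have "ip_dist V ip (\<phi> g x) (\<phi> g y) = ip_dist V ip x y"
    if "g \<in> carrier G" "x \<in> carrier V" "y \<in> carrier V" for g x y
    using that dist[of "j x" "j y"] j by (simp add: \<phi>_def dist act_in_H q_act_diff)
  ultimately have "isometric_action G (carrier V) (ip_dist V ip) \<phi>"
    by (simp add: isometric_action_def)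
  moreover have "ip_dist V ip (\<iota> 0) (\<phi> g (\<iota> 0)) = sqrt (D g \<one>)" if g: "g \<in> carrier G" for g
  proof -
    have "lin g 0 = 0" by (rule ext) (simp add: lin_def)
    then have "act g 0 = cocycle g" by (simp add: act_def)
    then show ?thesis
      using g zero_in_H ji dist cocycle_in_H[OF g] hilb.q_minus[OF cocycle_in_H[OF g]] q_cocycle[OF g]
      by (simp add: \<phi>_def)
  qed
  ultimately show thesis using that V ji(2)[OF zero_in_H] by blast
qed

end

section \<open>Groups acting on median spaces\<close>

lemma median_action_imp_hilbert_action:
  fixes G :: "('g, 'b) monoid_scheme" and X :: "'m set"
  assumes "group G" "countable (carrier G)" "(UNIV :: real set) \<lesssim> (UNIV :: 'h set)"
    and "median_space X d" and act: "isometric_action G X d \<phi>" and x: "x \<in> X"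
  obtains V :: "(real, 'h) module" and ip \<psi> v where "real_hilbert_space V ip"
    "isometric_action G (carrier V) (ip_dist V ip) \<psi>" "v \<in> carrier V"
    "\<And>g. g \<in> carrier G \<Longrightarrow> ip_dist V ip v (\<psi> g v) = sqrt (d x (\<phi> g x))"
proof -
  interpret median_space X d by fact
  interpret action: group_action G X \<phi> using act by (simp add: isometric_action_def)
  have orb: "\<phi> g x \<in> X" if "g \<in> carrier G" for g
    using isometric_action_closed[OF act that x] .
  define D where "D g h = d (\<phi> g x) (\<phi> h x)" for g h
  interpret negative_definite_kernel G D
  proof (intro negative_definite_kernel.intro assms(1) negative_definite_kernel_axioms.intro)
    show "D (k \<otimes>\<^bsub>G\<^esub> g) (k \<otimes>\<^bsub>G\<^esub> h) = D g h" if "k \<in> carrier G" "g \<in> carrier G" "h \<in> carrier G" for k g h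
      using that act orb x by (simp add: D_def action.composition_rule isometric_action_def)
    show "(\<Sum>g\<in>S. \<Sum>h\<in>S. c g * c h * D g h) \<le> 0"
      if "finite S" "S \<subseteq> carrier G" "sum c S = 0" for S c
      unfolding D_def using that orb by (intro dist_negative_definite) auto
  qed (simp_all add: D_def commute orb)
  have "D g \<one>\<^bsub>G\<^esub> = d x (\<phi> g x)" for g
    using x action.id_eq_one commute by (metis D_def restrict_apply')
  then show thesis using hilbert_action[OF assms(2,3)] that by metis
qed

theorem theorem1p3:
  fixes G :: "('g, 'b) monoid_scheme"
  assumes "group G"
    and "countable (carrier G)"
    and "(UNIV :: real set) \<lesssim> (UNIV :: 'h set)"
  shows "(kazhdan_group TYPE('h) G \<longrightarrow>
      (\<forall>(X :: 'm set) d \<phi>. median_space X d \<and> isometric_action G X d \<phi> \<longrightarrow>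
        bounded_action G X d \<phi>)) \<and>
    ((\<exists>(X :: 'm set) d \<phi>. median_space X d \<and> X \<noteq> {} \<and> isometric_action G X d \<phi> \<and>
        proper_action G X d \<phi>) \<longrightarrow>
      haagerup_group TYPE('h) G)"
proof (intro conjI impI allI)
  fix X :: "'m set" and d \<phi>
  assume T: "kazhdan_group TYPE('h) G" and "median_space X d \<and> isometric_action G X d \<phi>"
  then have med: "median_space X d" and act: "isometric_action G X d \<phi>" by auto
  interpret median_space X d by fact
  show "bounded_action G X d \<phi>"
    unfolding bounded_action_def
  proof
    fix x assume x: "x \<in> X"
    obtain V :: "(real, 'h) module" and ip \<psi> v where V: "real_hilbert_space V ip"
      and \<psi>: "isometric_action G (carrier V) (ip_dist V ip) \<psi>" and v: "v \<in> carrier V"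
      and eq: "\<And>g. g \<in> carrier G \<Longrightarrow> ip_dist V ip v (\<psi> g v) = sqrt (d x (\<phi> g x))"
      using median_action_imp_hilbert_action[OF assms med act x] by metis
    interpret V: real_hilbert_space V ip by (rule V)
    interpret V: Metric_space "carrier V" "ip_dist V ip" by (rule V.ip_Metric_space)
    obtain w where w: "w \<in> carrier V" "\<And>g. g \<in> carrier G \<Longrightarrow> \<psi> g w = w"
      using T V \<psi> unfolding kazhdan_group_def by blast
    \<comment> \<open>As \<open>w\<close> is fixed, \<open>v\<close> and its translates are all at
      distance \<open>?R\<close> from \<open>w\<close>, so \<open>v\<close> moves by at most twice
      that; \<open>d\<close> is the square of this displacement.\<close>
    let ?R = "ip_dist V ip v w"
    have "d x (\<phi> g x) \<le> (2 * ?R)\<^sup>2" if g: "g \<in> carrier G" for g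
    proof -
      have "ip_dist V ip w (\<psi> g v) = ip_dist V ip (\<psi> g w) (\<psi> g v)" using w g by simp
      also have "\<dots> = ip_dist V ip w v"
        using \<psi> w(1) v g unfolding isometric_action_def by blast
      also have "\<dots> = ?R" by (rule V.commute)
      finally have "sqrt (d x (\<phi> g x)) \<le> 2 * ?R"
        using V.triangle[OF v w(1) isometric_action_closed[OF \<psi> g v]] eq[OF g] by simp
      then show ?thesis by (rule sqrt_le_D)
    qed
    then have "orbit G \<phi> x \<subseteq> mcball x ((2 * ?R)\<^sup>2)"
      using isometric_action_closed[OF act _ x] x by (auto simp: orbit_def)
    then show "mbounded (orbit G \<phi> x)" unfolding mbounded_def by blast
  qed
next
  assume "\<exists>(X :: 'm set) d \<phi>. median_space X d \<and> X \<noteq> {} \<and> isometric_action G X d \<phi> \<and>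
    proper_action G X d \<phi>"
  then obtain X :: "'m set" and d \<phi> x where med: "median_space X d" and x: "x \<in> X"
    and act: "isometric_action G X d \<phi>" and proper: "proper_action G X d \<phi>" by auto
  obtain V :: "(real, 'h) module" and ip \<psi> v where V: "real_hilbert_space V ip"
    and \<psi>: "isometric_action G (carrier V) (ip_dist V ip) \<psi>" and v: "v \<in> carrier V"
    and eq: "\<And>g. g \<in> carrier G \<Longrightarrow> ip_dist V ip v (\<psi> g v) = sqrt (d x (\<phi> g x))"
    using median_action_imp_hilbert_action[OF assms med act x] by metis
  interpret V: real_hilbert_space V ip by (rule V)
  \<comment> \<open>A bound \<open>R\<close> on the Hilbert displacement is a bound
    \<open>R\<^sup>2\<close> on the median one.\<close>
  have "finite {g \<in> carrier G. ip_dist V ip v (\<psi> g v) \<le> R}" for R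
  proof (rule finite_subset)
    show "{g \<in> carrier G. ip_dist V ip v (\<psi> g v) \<le> R} \<subseteq> {g \<in> carrier G. d x (\<phi> g x) \<le> R\<^sup>2}"
      using eq sqrt_le_D by auto
    show "finite {g \<in> carrier G. d x (\<phi> g x) \<le> R\<^sup>2}"
      using proper x by (simp add: proper_action_def)
  qed
  then have "proper_action G (carrier V) (ip_dist V ip) \<psi>"
    using proper_action_iff_some[OF V.ip_Metric_space \<psi> v] by simp
  then show "haagerup_group TYPE('h) G" using V \<psi> unfolding haagerup_group_def by blast
qed

end
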